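(* Let $\mathbf{K}$ be a commutative ring and let $n,m\ge 1$ be integers. Let $P=\mathbf{K}[y_1,\dots,y_m]$, let $\mathrm{TS}^nP$ be the ring of symmetric tensors of order $n$ over $P$, let $A_P$ be the coordinate ring of $m$ generic commuting $n\times n$ matrices $\xi'_1,\dots,\xi'_m$, and let $C_P\subset A_P$ be the $\mathbf{K}$-subalgebra generated by the coefficients of the characteristic polynomials of the matrices $f(\xi'_1,\dots,\xi'_m)$, $f\in P$. Then the $\mathbf{K}$-algebra homomorphism $\alpha:\mathrm{TS}^nP\to A_P$ determined by $\alpha(f^{\otimes n})=\det(f(\xi'_1,\dots,\xi'_m))$ gives an isomorphism $\mathrm{TS}^nP\cong C_P$; that is, $\alpha$ is injective with image $C_P$.
   Context: $A=\mathbf{K}[\xi_{kij}]$ is the polynomial ring in the variables $\xi_{kij}$, $1\le i,j\le n$, $1\le k\le m$, and $\xi_k=(\xi_{kij})_{i,j}$ is the $k$-th generic $n\times n$ matrix. $A_P$ is the quotient of $A$ by the ideal generated by all entries of the matrices $\xi_k\xi_h-\xi_h\xi_k$, $1\le k,h\le m$; $\xi'_{kij}$ is the class of $\xi_{kij}$ in $A_P$, and $\xi'_k=(\xi'_{kij})_{i,j}\in\mathrm{Mat}(n,A_P)$ are the generic commuting matrices. $\pi_P:P\to\mathrm{Mat}(n,A_P)$ is the $\mathbf{K}$-algebra homomorphism with $\pi_P(y_k)=\xi'_k$, so $\pi_P(f)=f(\xi'_1,\dots,\xi'_m)$. For $f\in P$, elements $\psi_k(f)\in A_P$ are defined by $\det(tI_n-f(\xi'_1,\dots,\xi'_m))=t^n+\sum_{k=1}^n(-1)^k\psi_k(f)\,t^{n-k}$.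 $C_P$ is the $\mathbf{K}$-subalgebra of $A_P$ generated by all $\psi_k(f)$, $f\in P$, $1\le k\le n$. $P^{\otimes n}$ is the $n$-fold tensor power of $P$ over $\mathbf{K}$; the symmetric group $\mathfrak{S}_n$ acts on it by $\mathbf{K}$-algebra automorphisms permuting the factors, and $\mathrm{TS}^nP=(P^{\otimes n})^{\mathfrak{S}_n}$. The composition $\det\cdot\pi_P:P\to A_P$ is a multiplicative polynomial law homogeneous of degree $n$. By a theorem of Roby there is a unique $\mathbf{K}$-algebra homomorphism $\alpha:\mathrm{TS}^nP\to A_P$ corresponding to it, i.e. such that $\alpha(f^{\otimes n})=\det(f(\xi'_1,\dots,\xi'_m))$ for $f\in P$, and likewise after base change: for every commutative $\mathbf{K}$-algebra $S$ and every $f\in S\otimes_{\mathbf{K}} P=S[y_1,\dots,y_m]$, one has $(\mathrm{id}_S\otimes\alpha)(f^{\otimes n})=\det(f(\xi'_1,\dots,\xi'_m))$ in $S\otimes_{\mathbf{K}}A_P$, where $f^{\otimes n}$ is the $n$-fold tensor power over $S$, regarded as an element of $S\otimes_{\mathbf{K}}\mathrm{TS}^nP$. *)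

theory Defs
  imports
    "HOL-Analysis.Analysis"
    "HOL-Library.Poly_Mapping"
    "HOL-Library.FuncSet"
    "HOL-Combinatorics.Perm"
    "HOL-Computational_Algebra.Polynomial"
begin

section \<open>Polynomial rings, ideals, subalgebras\<close>

text \<open>Polynomials over \<open>'k\<close> in the variables \<open>'x\<close>: finitely supported functions on
  monomials, with the convolution product of \<^theory>\<open>HOL-Library.Poly_Mapping\<close>.\<close>

type_synonym ('k, 'x) mpoly = "('x \<Rightarrow>\<^sub>0 nat) \<Rightarrow>\<^sub>0 'k"

definition Const :: "'k::comm_ring_1 \<Rightarrow> 'a::comm_monoid_add \<Rightarrow>\<^sub>0 'k" where
  "Const c = Poly_Mapping.single 0 c"

definition Var :: "'x \<Rightarrow> ('k::comm_ring_1, 'x) mpoly" where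
  "Var x = Poly_Mapping.single (Poly_Mapping.single x 1) 1"

interpretation ring_module: module "(*) :: 'a::comm_ring_1 \<Rightarrow> 'a \<Rightarrow> 'a"
  by standard (simp_all add: algebra_simps)

text \<open>Ideals are the submodules of the ring seen as a module over itself.\<close>

abbreviation ideal_generated :: "'a::comm_ring_1 set \<Rightarrow> 'a set" where
  "ideal_generated \<equiv> module.span (*)"

text \<open>The map \<open>\<iota>\<close> is the structure map of the algebra.\<close>

definition is_subalgebra :: "('k \<Rightarrow> 'a::comm_ring_1) \<Rightarrow> 'a set \<Rightarrow> bool" where
  "is_subalgebra \<iota> B \<longleftrightarrow> range \<iota> \<subseteq> B \<and>
     (\<forall>x\<in>B. \<forall>y\<in>B. x + y \<in> B \<and> x - y \<in> B \<and> x * y \<in> B)"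

definition subalgebra_generated :: "('k \<Rightarrow> 'a::comm_ring_1) \<Rightarrow> 'a set \<Rightarrow> 'a set" where
  "subalgebra_generated \<iota> G = is_subalgebra \<iota> hull G"

lemma ideal_eq_cong: "a = b \<Longrightarrow> a - b \<in> ideal_generated G"
  by (simp add: ring_module.span_zero)

lemma ideal_add_cong:
  fixes a :: "'a::comm_ring_1"
  assumes "a - a' \<in> ideal_generated G" "b - b' \<in> ideal_generated G"
  shows "(a + b) - (a' + b') \<in> ideal_generated G"
  using ring_module.span_add[OF assms] by (simp add: algebra_simps)

lemma ideal_diff_cong:
  fixes a :: "'a::comm_ring_1"
  assumes "a - a' \<in> ideal_generated G" "b - b' \<in> ideal_generated G"
  shows "(a - b) - (a' - b') \<in> ideal_generated G"
  using ring_module.span_diff[OF assms] by (simp add: algebra_simps)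

lemma ideal_uminus_cong:
  fixes a :: "'a::comm_ring_1"
  assumes "a - a' \<in> ideal_generated G"
  shows "(- a) - (- a') \<in> ideal_generated G"
  using ring_module.span_neg[OF assms] by (simp add: algebra_simps)

lemma ideal_mult_cong:
  fixes a :: "'a::comm_ring_1"
  assumes "a - a' \<in> ideal_generated G" "b - b' \<in> ideal_generated G"
  shows "a * b - a' * b' \<in> ideal_generated G"
proof -
  have "a * b - a' * b' = b * (a - a') + a' * (b - b')"
    by (simp add: algebra_simps)
  then show ?thesis
    using ring_module.span_add[OF ring_module.span_scale[OF assms(1), of b]
        ring_module.span_scale[OF assms(2), of a']] by simp
qed

lemma equivp_ideal: "equivp (\<lambda>p q :: 'a::comm_ring_1. p - q \<in> ideal_generated G)"
proof (rule equivpI)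
  show "reflp (\<lambda>p q :: 'a. p - q \<in> ideal_generated G)"
    by (simp add: reflp_def ring_module.span_zero)
  show "symp (\<lambda>p q :: 'a. p - q \<in> ideal_generated G)"
    by (metis (mono_tags, lifting) minus_diff_eq ring_module.span_neg sympI)
  show "transp (\<lambda>p q :: 'a. p - q \<in> ideal_generated G)"
  proof (rule transpI)
    fix x y z :: 'a
    assume "x - y \<in> ideal_generated G" "y - z \<in> ideal_generated G"
    from ring_module.span_add[OF this] show "x - z \<in> ideal_generated G" by simp
  qed
qed

lemma ideal_generated_subset_kernel:
  fixes h :: "'a::comm_ring_1 \<Rightarrow> 'b::comm_ring_1"
  assumes "x \<in> ideal_generated G"
    and "\<And>x y. h (x + y) = h x + h y" "\<And>x y. h (x * y) = h x * h y"
    and "\<And>g. g \<in> G \<Longrightarrow> h g = 0"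
  shows "h x = 0"
proof -
  have h0: "h 0 = 0" using assms(2)[of 0 0] by simp
  show ?thesis using assms(1)
    by (induction rule: ring_module.span_induct_alt) (simp_all add: h0 assms(2-4))
qed

section \<open>Maps on monoid algebras\<close>

lemma poly_mapping_additive_induct [case_names zero single add]:
  fixes p :: "'a \<Rightarrow>\<^sub>0 'b::comm_monoid_add"
  assumes "P 0" and "\<And>k v. P (Poly_Mapping.single k v)"
    and "\<And>p q. P p \<Longrightarrow> P q \<Longrightarrow> P (p + q)"
  shows "P p"
proof (induction p rule: Poly_Mapping.update_induct)
  case const
  then show ?case by (rule assms(1))
next
  case (update f a b)
  have "Poly_Mapping.update a b f = f + Poly_Mapping.single a b"
    using update(1)
    by (intro poly_mapping_eqI)
       (simp add: lookup_update lookup_add lookup_single in_keys_iff when_def, metis add_0)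
  with update assms(2,3) show ?case by metis
qed

text \<open>The linear extension to a monoid algebra of a map \<open>\<phi>\<close> defined on the monoid.\<close>

definition linear_extension :: "('a \<Rightarrow> 'b::comm_ring_1) \<Rightarrow> ('a \<Rightarrow>\<^sub>0 'b) \<Rightarrow> 'b" where
  "linear_extension \<phi> p = (\<Sum>a\<in>Poly_Mapping.keys p. Poly_Mapping.lookup p a * \<phi> a)"

lemma linear_extension_superset:
  assumes "finite A" "Poly_Mapping.keys p \<subseteq> A"
  shows "linear_extension \<phi> p = (\<Sum>a\<in>A. Poly_Mapping.lookup p a * \<phi> a)"
  unfolding linear_extension_def using assms
  by (intro sum.mono_neutral_left) (auto simp: in_keys_iff)

lemma linear_extension_add:
  "linear_extension \<phi> (p + q) = linear_extension \<phi> p + linear_extension \<phi> q"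
proof -
  let ?A = "Poly_Mapping.keys p \<union> Poly_Mapping.keys q"
  have "linear_extension \<phi> r = (\<Sum>a\<in>?A. Poly_Mapping.lookup r a * \<phi> a)"
    if "r \<in> {p, q, p + q}" for r
    using that keys_add[of p q] by (intro linear_extension_superset) auto
  then show ?thesis
    by (simp add: lookup_add ring_distribs sum.distrib)
qed

lemma linear_extension_single [simp]:
  "linear_extension \<phi> (Poly_Mapping.single a c) = c * \<phi> a"
  by (cases "c = 0") (simp_all add: linear_extension_def)

lemma linear_extension_zero [simp]: "linear_extension \<phi> 0 = 0"
  by (simp add: linear_extension_def)

lemma linear_extension_diff:
  "linear_extension \<phi> (p - q) = linear_extension \<phi> p - linear_extension \<phi> q"
  using linear_extension_add[of \<phi> "p - q" q] by (simp add: algebra_simps)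

lemma linear_extension_mult:
  fixes \<phi> :: "'a::comm_monoid_add \<Rightarrow> 'b::comm_ring_1"
  assumes "\<And>a b. \<phi> (a + b) = \<phi> a * \<phi> b"
  shows "linear_extension \<phi> (p * q) = linear_extension \<phi> p * linear_extension \<phi> q"
proof (induction p rule: poly_mapping_additive_induct)
  case (single k v)
  show ?case
    by (induction q rule: poly_mapping_additive_induct)
       (simp_all add: mult_single assms linear_extension_add ring_distribs)
qed (simp_all add: linear_extension_add ring_distribs)

lemma map_key_mult:
  fixes g :: "'a::comm_monoid_add \<Rightarrow> 'a" and p q :: "'a \<Rightarrow>\<^sub>0 'b::comm_ring_1"
  assumes "bij g" "\<And>a b. g (a + b) = g a + g b"
  shows "Poly_Mapping.map_key g (p * q) = Poly_Mapping.map_key g p * Poly_Mapping.map_key g q"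
proof -
  have inj: "inj g" using assms(1) by (rule bij_is_inj)
  have single: "Poly_Mapping.map_key g (Poly_Mapping.single k v) = Poly_Mapping.single (inv g k) v"
    for k and v :: 'b
    using map_key_single[OF inj, of "inv g k" v] assms(1) by (simp add: bij_is_surj surj_f_inv_f)
  have inv: "inv g (a + b) = inv g a + inv g b" for a b
    by (metis assms bij_inv_eq_iff)
  show ?thesis
  proof (induction p rule: poly_mapping_additive_induct)
    case (single k v)
    show ?case
      by (induction q rule: poly_mapping_additive_induct)
         (simp_all add: mult_single \<open>\<And>k v. Poly_Mapping.map_key g (Poly_Mapping.single k v) = _\<close>
            inv map_key_plus[OF inj] map_key_zero[OF inj] ring_distribs)
  qed (simp_all add: map_key_plus[OF inj] map_key_zero[OF inj] ring_distribs)
qed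

section \<open>The coordinate ring of generic commuting matrices\<close>

text \<open>The variable \<open>(k, i, j)\<close> is the \<open>(i, j)\<close> entry of the \<open>k\<close>-th generic matrix.\<close>

definition generic_matrix :: "'m \<Rightarrow> ('k::comm_ring_1, 'm \<times> 'n \<times> 'n) mpoly ^ 'n ^ 'n" where
  "generic_matrix k = (\<chi> i j. Var (k, i, j))"

definition commutator_entries :: "('k::comm_ring_1, 'm \<times> 'n \<times> 'n::finite) mpoly set" where
  "commutator_entries =
     {(generic_matrix k ** generic_matrix h - generic_matrix h ** generic_matrix k) $ i $ j
       | k h i j. True}"

lifting_forget poly_mapping.lifting

quotient_type (overloaded) ('k, 'm, 'n) AP = "('k::comm_ring_1, 'm \<times> 'n \<times> 'n::finite) mpoly" /
    "\<lambda>p q. p - q \<in> ideal_generated commutator_entries"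
  by (rule equivp_ideal)

lemma commutator_entries_proper:
  "(1 :: ('k::comm_ring_1, 'm \<times> 'n \<times> 'n::finite) mpoly) \<notin> ideal_generated commutator_entries"
proof
  let ?\<epsilon> = "\<lambda>a :: ('m \<times> 'n \<times> 'n) \<Rightarrow>\<^sub>0 nat. if a = 0 then 1 else 0 :: 'k"
  have plus0: "a + b = 0 \<longleftrightarrow> a = 0 \<and> b = 0" for a b :: "('m \<times> 'n \<times> 'n) \<Rightarrow>\<^sub>0 nat"
    by (auto simp: poly_mapping_eq_iff lookup_add fun_eq_iff)
  have mult: "linear_extension ?\<epsilon> (p * q) = linear_extension ?\<epsilon> p * linear_extension ?\<epsilon> q" for p q
    by (rule linear_extension_mult) (auto simp: plus0)
  have sum: "linear_extension ?\<epsilon> (sum f A) = (\<Sum>x\<in>A. linear_extension ?\<epsilon> (f x))"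
    for f :: "'n \<Rightarrow> _" and A
    by (induction A rule: infinite_finite_induct) (simp_all add: linear_extension_add)
  have var: "linear_extension ?\<epsilon> (Var x) = 0" for x
  proof -
    have "Poly_Mapping.single x (1 :: nat) \<noteq> 0"
      by (metis lookup_single_eq lookup_zero zero_neq_one)
    then show ?thesis by (simp add: Var_def)
  qed
  assume "(1 :: ('k, 'm \<times> 'n \<times> 'n) mpoly) \<in> ideal_generated commutator_entries"
  then have "linear_extension ?\<epsilon> 1 = 0"
  proof (rule ideal_generated_subset_kernel)
    fix g :: "('k, 'm \<times> 'n \<times> 'n) mpoly"
    assume "g \<in> commutator_entries"
    then show "linear_extension ?\<epsilon> g = 0"
      by (auto simp: commutator_entries_def generic_matrix_def matrix_matrix_mult_def
          linear_extension_diff sum mult var)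
  qed (auto simp: linear_extension_add mult)
  then show False
    using linear_extension_single[of ?\<epsilon> 0 1] by simp
qed

instantiation AP :: (comm_ring_1, type, finite) comm_ring_1
begin

lift_definition zero_AP :: "('a, 'b, 'c) AP" is 0 .
lift_definition one_AP :: "('a, 'b, 'c) AP" is 1 .
lift_definition plus_AP :: "('a, 'b, 'c) AP \<Rightarrow> ('a, 'b, 'c) AP \<Rightarrow> ('a, 'b, 'c) AP" is "(+)"
  by (rule ideal_add_cong)
lift_definition minus_AP :: "('a, 'b, 'c) AP \<Rightarrow> ('a, 'b, 'c) AP \<Rightarrow> ('a, 'b, 'c) AP" is "(-)"
  by (rule ideal_diff_cong)
lift_definition uminus_AP :: "('a, 'b, 'c) AP \<Rightarrow> ('a, 'b, 'c) AP" is "uminus"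
  by (rule ideal_uminus_cong)
lift_definition times_AP :: "('a, 'b, 'c) AP \<Rightarrow> ('a, 'b, 'c) AP \<Rightarrow> ('a, 'b, 'c) AP" is "(*)"
  by (rule ideal_mult_cong)

instance
proof
  fix a b c :: "('a, 'b, 'c) AP"
  show "a * b * c = a * (b * c)" by transfer (rule ideal_eq_cong, rule mult.assoc)
  show "a * b = b * a" by transfer (rule ideal_eq_cong, rule mult.commute)
  show "1 * a = a" by transfer (rule ideal_eq_cong, rule mult_1_left)
  show "a + b + c = a + (b + c)" by transfer (rule ideal_eq_cong, rule add.assoc)
  show "a + b = b + a" by transfer (rule ideal_eq_cong, rule add.commute)
  show "0 + a = a" by transfer (rule ideal_eq_cong, rule add_0)
  show "- a + a = 0" by transfer (rule ideal_eq_cong, rule left_minus)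
  show "a - b = a + - b" by transfer (rule ideal_eq_cong, rule diff_conv_add_uminus)
  show "(a + b) * c = a * c + b * c" by transfer (rule ideal_eq_cong, rule distrib_right)
  show "(0 :: ('a, 'b, 'c) AP) \<noteq> 1"
    by transfer (use commutator_entries_proper ring_module.span_neg in fastforce)
qed

end

lift_definition AP_class :: "('k::comm_ring_1, 'm \<times> 'n \<times> 'n::finite) mpoly \<Rightarrow> ('k, 'm, 'n) AP"
  is "\<lambda>p. p" .

definition AP_const :: "'k::comm_ring_1 \<Rightarrow> ('k, 'm, 'n::finite) AP" where
  "AP_const c = AP_class (Const c)"

definition commuting_matrix :: "'m \<Rightarrow> ('k::comm_ring_1, 'm, 'n::finite) AP ^ 'n ^ 'n" where
  "commuting_matrix k = (\<chi> i j. AP_class (generic_matrix k $ i $ j))"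

lemma AP_class_add: "AP_class (p + q) = AP_class p + AP_class q"
  by transfer (simp add: ring_module.span_zero)

lemma AP_class_mult: "AP_class (p * q) = AP_class p * AP_class q"
  by transfer (simp add: ring_module.span_zero)

lemma AP_class_sum: "AP_class (sum f A) = (\<Sum>x\<in>A. AP_class (f x))"
proof (induction A rule: infinite_finite_induct)
  have "AP_class 0 = 0" by transfer (simp add: ring_module.span_zero)
  then show "AP_class (sum f A) = (\<Sum>x\<in>A. AP_class (f x))" if "infinite A" for A
    using that by simp
  show "AP_class (sum f {}) = (\<Sum>x\<in>{}. AP_class (f x))"
    using \<open>AP_class 0 = 0\<close> by simp
qed (simp add: AP_class_add)

lemma commuting_matrix_commute:
  fixes k h :: 'm
  defines "X \<equiv> commuting_matrix :: 'm \<Rightarrow> ('k::comm_ring_1, 'm, 'n::finite) AP ^ 'n ^ 'n"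
  shows "X k ** X h = X h ** X k"
proof -
  let ?G = "generic_matrix :: 'm \<Rightarrow> ('k, 'm \<times> 'n \<times> 'n) mpoly ^ 'n ^ 'n"
  have entry: "(X a ** X b) $ i $ j = AP_class ((?G a ** ?G b) $ i $ j)" for a b i j
    by (simp add: X_def commuting_matrix_def matrix_matrix_mult_def AP_class_sum AP_class_mult)
  have "AP_class ((?G k ** ?G h) $ i $ j) = AP_class ((?G h ** ?G k) $ i $ j)" for i j
  proof -
    have "(?G k ** ?G h) $ i $ j - (?G h ** ?G k) $ i $ j \<in> commutator_entries"
      unfolding commutator_entries_def by (intro CollectI exI[of _ k] exI[of _ h] exI[of _ i] exI[of _ j]) simp
    then show ?thesis by transfer (rule ring_module.span_base)
  qed
  then show ?thesis by (simp add: vec_eq_iff entry)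
qed

text \<open>The homomorphism \<open>\<pi>\<^sub>P\<close>, i.e. evaluation at the generic commuting matrices. The fold is
  independent of the order of the factors because these matrices commute.\<close>

definition eval_monomial :: "('m::finite \<Rightarrow>\<^sub>0 nat) \<Rightarrow> ('k::comm_ring_1, 'm, 'n::finite) AP ^ 'n ^ 'n" where
  "eval_monomial \<mu> =
     Finite_Set.fold (\<lambda>k M. (((**) (commuting_matrix k)) ^^ Poly_Mapping.lookup \<mu> k) M) (mat 1) UNIV"

definition eval_poly :: "('k::comm_ring_1, 'm::finite) mpoly \<Rightarrow> ('k, 'm, 'n::finite) AP ^ 'n ^ 'n" where
  "eval_poly f =
     (\<Sum>\<mu>\<in>Poly_Mapping.keys f. mat (AP_const (Poly_Mapping.lookup f \<mu>)) ** eval_monomial \<mu>)"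

lemma comp_fun_commute_eval:
  "comp_fun_commute (\<lambda>k M. (((**) (commuting_matrix k :: ('k::comm_ring_1, 'm, 'n::finite) AP ^ 'n ^ 'n))
     ^^ Poly_Mapping.lookup \<mu> k) M)"
proof
  fix k h :: 'm
  let ?X = "commuting_matrix :: 'm \<Rightarrow> ('k, 'm, 'n) AP ^ 'n ^ 'n"
  have one: "(**) (?X k) \<circ> (**) (?X h) = (**) (?X h) \<circ> (**) (?X k)" for k h
    by (simp add: fun_eq_iff matrix_mul_assoc commuting_matrix_commute[of k h])
  have pow: "(g ^^ a) \<circ> f = f \<circ> (g ^^ a)" if "g \<circ> f = f \<circ> g" for f g :: "'z \<Rightarrow> 'z" and a
    using that by (induction a) (simp_all add: fun_eq_iff)
  show "((**) (?X h) ^^ Poly_Mapping.lookup \<mu> h) \<circ> ((**) (?X k) ^^ Poly_Mapping.lookup \<mu> k) =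
      ((**) (?X k) ^^ Poly_Mapping.lookup \<mu> k) \<circ> ((**) (?X h) ^^ Poly_Mapping.lookup \<mu> h)"
    by (intro pow) (simp add: pow[OF one, symmetric] flip: pow)
qed

lemma eval_poly_Var:
  "eval_poly (Var k :: ('k::comm_ring_1, 'm::finite) mpoly) =
     (commuting_matrix k :: ('k, 'm, 'n::finite) AP ^ 'n ^ 'n)"
proof -
  let ?f = "\<lambda>h M :: ('k, 'm, 'n) AP ^ 'n ^ 'n.
     (((**) (commuting_matrix h)) ^^ Poly_Mapping.lookup (Poly_Mapping.single k 1) h) M"
  interpret comp_fun_commute ?f by (rule comp_fun_commute_eval)
  have rest: "Finite_Set.fold ?f M A = M" if "finite A" "k \<notin> A" for A M
    using that
  proof (induction A)
    case (insert h A)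
    then have "k \<noteq> h" and IH: "Finite_Set.fold ?f M A = M" by blast+
    then have 0: "Poly_Mapping.lookup (Poly_Mapping.single k 1) h = (0 :: nat)"
      by (simp add: lookup_single_not_eq)
    show ?case
      unfolding fold_insert[OF insert.hyps] IH 0 by simp
  qed simp
  have "Finite_Set.fold ?f (mat 1) UNIV = ?f k (Finite_Set.fold ?f (mat 1) (UNIV - {k}))"
    by (rule fold_rec) auto
  also have "\<dots> = ?f k (mat 1)"
    by (subst rest) auto
  finally have "eval_monomial (Poly_Mapping.single k 1) = (commuting_matrix k :: ('k, 'm, 'n) AP ^ 'n ^ 'n)"
    by (simp add: eval_monomial_def)
  moreover have "AP_const 1 = (1 :: ('k, 'm, 'n) AP)"
    unfolding AP_const_def Const_def single_one
    by transfer (rule ideal_eq_cong, rule refl)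
  ultimately show ?thesis
    by (simp add: eval_poly_def Var_def)
qed

definition charpoly :: "'a::comm_ring_1 ^ 'n ^ 'n::finite \<Rightarrow> 'a poly" where
  "charpoly M = det (mat [:0, 1:] - (\<chi> i j. [:M $ i $ j:]))"

definition charpoly_coeff :: "nat \<Rightarrow> ('k::comm_ring_1, 'm::finite) mpoly \<Rightarrow> ('k, 'm, 'n::finite) AP" where
  "charpoly_coeff k f =
     (- 1) ^ k * coeff (charpoly (eval_poly f :: ('k, 'm, 'n) AP ^ 'n ^ 'n)) (CARD('n) - k)"

definition CP :: "('k::comm_ring_1, 'm::finite, 'n::finite) AP set" where
  "CP = subalgebra_generated AP_const {charpoly_coeff k f | k f. 1 \<le> k \<and> k \<le> CARD('n)}"

section \<open>Tensor powers and symmetric tensors\<close>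

text \<open>A family \<open>v\<close> of polynomials, indexed by the tensor slots \<open>'n\<close>, names the pure tensor
  \<open>v\<^sub>1 \<otimes> \<dots> \<otimes> v\<^sub>n\<close>. The families form a commutative monoid under slotwise multiplication, which is
  written additively so that finitely supported functions on families are its monoid algebra.\<close>

datatype ('n, 'p) slots = Slots (slot: "'n \<Rightarrow> 'p")

instantiation slots :: (type, comm_monoid_mult) comm_monoid_add
begin

definition zero_slots :: "('a, 'b) slots" where "0 = Slots (\<lambda>_. 1)"
definition plus_slots :: "('a, 'b) slots \<Rightarrow> ('a, 'b) slots \<Rightarrow> ('a, 'b) slots" where
  "u + v = Slots (\<lambda>i. slot u i * slot v i)"

instance
  by standard (auto simp: zero_slots_def plus_slots_def mult_ac intro: slots.expand)

end

text \<open>The \<open>n\<close>-fold tensor power of \<open>P = K[y\<^sub>1, \<dots>, y\<^sub>m]\<close> over \<open>K\<close>: the free \<open>K\<close>-module on all families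
  modulo the multilinearity relations. The product of a relation with a family is again a
  relation, so the \<open>K\<close>-submodule and the ideal generated by the relations coincide.\<close>

definition multilinear_relations ::
    "(('n, ('k::comm_ring_1, 'm) mpoly) slots \<Rightarrow>\<^sub>0 'k) set" where
  "multilinear_relations =
     {Poly_Mapping.single (Slots (v(i := a + b))) 1
        - Poly_Mapping.single (Slots (v(i := a))) 1
        - Poly_Mapping.single (Slots (v(i := b))) 1 | v i a b. True} \<union>
     {Poly_Mapping.single (Slots (v(i := Const c * a))) 1
        - Poly_Mapping.single (Slots (v(i := a))) c | v i a c. True}"

quotient_type (overloaded) ('k, 'm, 'n) tensor_power =
    "('n, ('k::comm_ring_1, 'm) mpoly) slots \<Rightarrow>\<^sub>0 'k" /
    "\<lambda>x y. x - y \<in> ideal_generated multilinear_relations"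
  by (rule equivp_ideal)

lemma multilinear_relations_proper:
  "(1 :: ('n::finite, ('k::comm_ring_1, 'm) mpoly) slots \<Rightarrow>\<^sub>0 'k)
     \<notin> ideal_generated multilinear_relations"
proof
  let ?\<epsilon> = "linear_extension (\<lambda>a :: 'm \<Rightarrow>\<^sub>0 nat. if a = 0 then 1 else 0 :: 'k)"
  let ?h = "linear_extension (\<lambda>v :: ('n, ('k, 'm) mpoly) slots. \<Prod>i\<in>UNIV. ?\<epsilon> (slot v i))"
  have plus0: "a + b = 0 \<longleftrightarrow> a = 0 \<and> b = 0" for a b :: "'m \<Rightarrow>\<^sub>0 nat"
    by (auto simp: poly_mapping_eq_iff lookup_add fun_eq_iff)
  have mult: "?\<epsilon> (p * q) = ?\<epsilon> p * ?\<epsilon> q" for p q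
    by (rule linear_extension_mult) (auto simp: plus0)
  have hmult: "?h (p * q) = ?h p * ?h q" for p q
    by (rule linear_extension_mult) (simp add: plus_slots_def mult prod.distrib)
  have upd: "(\<Prod>j\<in>UNIV. ?\<epsilon> ((v(i := a)) j)) = ?\<epsilon> a * (\<Prod>j\<in>UNIV - {i}. ?\<epsilon> (v j))"
    for v :: "'n \<Rightarrow> ('k, 'm) mpoly" and i a
    by (subst prod.remove[of UNIV i]) (auto intro!: prod.cong arg_cong2[of _ _ _ _ "(*)"])
  assume "(1 :: ('n, ('k, 'm) mpoly) slots \<Rightarrow>\<^sub>0 'k) \<in> ideal_generated multilinear_relations"
  then have "?h 1 = 0"
  proof (rule ideal_generated_subset_kernel)
    fix g :: "('n, ('k, 'm) mpoly) slots \<Rightarrow>\<^sub>0 'k"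
    assume g: "g \<in> multilinear_relations"
    have "?h (Poly_Mapping.single (Slots (v(i := a + b))) 1
        - Poly_Mapping.single (Slots (v(i := a))) 1
        - Poly_Mapping.single (Slots (v(i := b))) 1) = 0" for v i a b
      unfolding linear_extension_diff linear_extension_single slots.sel upd linear_extension_add
      by (simp add: ring_distribs)
    moreover have "?h (Poly_Mapping.single (Slots (v(i := Const c * a))) 1
        - Poly_Mapping.single (Slots (v(i := a))) c) = 0" for v i a c
    proof -
      have "?\<epsilon> (Const c * a) = c * ?\<epsilon> a"
        unfolding mult by (simp add: Const_def)
      then show ?thesis
        unfolding linear_extension_diff linear_extension_single slots.sel upd
        by (simp only: mult.assoc mult_1_left diff_self)
    qed
    ultimately show "?h g = 0"
      using g unfolding multilinear_relations_def by (elim UnE CollectE exE conjE) simp_all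
  qed (auto simp: linear_extension_add hmult)
  moreover have "?\<epsilon> 1 = 1"
    using linear_extension_single[of "\<lambda>a :: 'm \<Rightarrow>\<^sub>0 nat. if a = 0 then 1 else 0 :: 'k" 0 1] by simp
  moreover have "?h 1 = (\<Prod>i\<in>UNIV. ?\<epsilon> (slot (0 :: ('n, ('k, 'm) mpoly) slots) i))"
    using linear_extension_single[of
        "\<lambda>v :: ('n, ('k, 'm) mpoly) slots. \<Prod>i\<in>UNIV. ?\<epsilon> (slot v i)" 0 1] by simp
  ultimately show False
    by (simp add: zero_slots_def)
qed

instantiation tensor_power :: (comm_ring_1, type, finite) comm_ring_1
begin

lift_definition zero_tensor_power :: "('a, 'b, 'c) tensor_power" is 0 .
lift_definition one_tensor_power :: "('a, 'b, 'c) tensor_power" is 1 .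
lift_definition plus_tensor_power ::
    "('a, 'b, 'c) tensor_power \<Rightarrow> ('a, 'b, 'c) tensor_power \<Rightarrow> ('a, 'b, 'c) tensor_power" is "(+)"
  by (rule ideal_add_cong)
lift_definition minus_tensor_power ::
    "('a, 'b, 'c) tensor_power \<Rightarrow> ('a, 'b, 'c) tensor_power \<Rightarrow> ('a, 'b, 'c) tensor_power" is "(-)"
  by (rule ideal_diff_cong)
lift_definition uminus_tensor_power ::
    "('a, 'b, 'c) tensor_power \<Rightarrow> ('a, 'b, 'c) tensor_power" is "uminus"
  by (rule ideal_uminus_cong)
lift_definition times_tensor_power ::
    "('a, 'b, 'c) tensor_power \<Rightarrow> ('a, 'b, 'c) tensor_power \<Rightarrow> ('a, 'b, 'c) tensor_power" is "(*)"
  by (rule ideal_mult_cong)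

instance
proof
  fix a b c :: "('a, 'b, 'c) tensor_power"
  show "a * b * c = a * (b * c)" by transfer (rule ideal_eq_cong, rule mult.assoc)
  show "a * b = b * a" by transfer (rule ideal_eq_cong, rule mult.commute)
  show "1 * a = a" by transfer (rule ideal_eq_cong, rule mult_1_left)
  show "a + b + c = a + (b + c)" by transfer (rule ideal_eq_cong, rule add.assoc)
  show "a + b = b + a" by transfer (rule ideal_eq_cong, rule add.commute)
  show "0 + a = a" by transfer (rule ideal_eq_cong, rule add_0)
  show "- a + a = 0" by transfer (rule ideal_eq_cong, rule left_minus)
  show "a - b = a + - b" by transfer (rule ideal_eq_cong, rule diff_conv_add_uminus)
  show "(a + b) * c = a * c + b * c" by transfer (rule ideal_eq_cong, rule distrib_right)
  show "(0 :: ('a, 'b, 'c) tensor_power) \<noteq> 1"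
    by transfer (use multilinear_relations_proper ring_module.span_neg in fastforce)
qed

end

lift_definition tensor_class ::
    "(('n, ('k::comm_ring_1, 'm) mpoly) slots \<Rightarrow>\<^sub>0 'k) \<Rightarrow> ('k, 'm, 'n::finite) tensor_power"
  is "\<lambda>x. x" .

definition tensor_const :: "'k::comm_ring_1 \<Rightarrow> ('k, 'm, 'n::finite) tensor_power" where
  "tensor_const c = tensor_class (Const c)"

definition pure_tensor :: "('n \<Rightarrow> ('k::comm_ring_1, 'm) mpoly) \<Rightarrow> ('k, 'm, 'n::finite) tensor_power" where
  "pure_tensor v = tensor_class (Poly_Mapping.single (Slots v) 1)"

text \<open>The embedding \<open>f \<mapsto> 1 \<otimes> \<dots> \<otimes> f \<otimes> \<dots> \<otimes> 1\<close> of \<open>P\<close> into slot \<open>i\<close>.\<close>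

definition slot_embedding :: "'n \<Rightarrow> ('k::comm_ring_1, 'm) mpoly \<Rightarrow> ('k, 'm, 'n::finite) tensor_power" where
  "slot_embedding i f = pure_tensor ((\<lambda>_. 1)(i := f))"

definition permute_slots :: "'n perm \<Rightarrow> ('n, 'p) slots \<Rightarrow> ('n, 'p) slots" where
  "permute_slots \<sigma> v = Slots (slot v \<circ> Perm.apply \<sigma>)"

lemma permute_slots_add:
  "permute_slots \<sigma> (u + v) = permute_slots \<sigma> u + permute_slots \<sigma> v"
  by (simp add: permute_slots_def plus_slots_def o_def)

lemma permute_slots_inverse:
  "permute_slots \<sigma> (permute_slots (inverse \<sigma>) v) = v"
  "permute_slots (inverse \<sigma>) (permute_slots \<sigma> v) = v"
  by (simp_all add: permute_slots_def o_def Perm.apply_inverse bij_is_inj bij_is_surj surj_f_inv_f)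

lemma bij_permute_slots: "bij (permute_slots \<sigma>)"
  using permute_slots_inverse by (metis bijI')

lemma map_key_permute_single:
  fixes c :: "'k::zero"
  shows "Poly_Mapping.map_key (permute_slots \<sigma>) (Poly_Mapping.single (Slots w) c) =
    Poly_Mapping.single (Slots (w \<circ> Perm.apply (inverse \<sigma>))) c"
proof -
  have "Slots w = permute_slots \<sigma> (permute_slots (inverse \<sigma>) (Slots w))"
    by (simp add: permute_slots_inverse)
  then show ?thesis
    using map_key_single[OF bij_is_inj[OF bij_permute_slots],
        of \<sigma> "permute_slots (inverse \<sigma>) (Slots w)" c]
    by (simp add: permute_slots_def)
qed

lemma fun_upd_comp_perm:
  "v(i := a) \<circ> Perm.apply (inverse \<sigma>) =
    (v \<circ> Perm.apply (inverse \<sigma>))(Perm.apply \<sigma> i := a)"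
proof
  fix j
  have "Perm.apply (inverse \<sigma>) j = i \<longleftrightarrow> j = Perm.apply \<sigma> i"
    by (metis Perm.apply_inverse bij_apply bij_inv_eq_iff)
  then show "(v(i := a) \<circ> Perm.apply (inverse \<sigma>)) j =
      ((v \<circ> Perm.apply (inverse \<sigma>))(Perm.apply \<sigma> i := a)) j"
    by simp
qed

lemma map_key_diff:
  fixes p q :: "'a \<Rightarrow>\<^sub>0 'b::ab_group_add"
  assumes "inj g"
  shows "Poly_Mapping.map_key g (p - q) = Poly_Mapping.map_key g p - Poly_Mapping.map_key g q"
  using map_key_plus[OF assms, of "p - q" q] by (simp add: algebra_simps)

lemma permute_slots_relations:
  fixes g :: "('n, ('k::comm_ring_1, 'm) mpoly) slots \<Rightarrow>\<^sub>0 'k"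
  assumes "g \<in> multilinear_relations"
  shows "Poly_Mapping.map_key (permute_slots \<sigma>) g \<in> multilinear_relations"
  using assms unfolding multilinear_relations_def
  by (elim UnE CollectE exE conjE;
      simp only: map_key_diff[OF bij_is_inj[OF bij_permute_slots]]
        map_key_permute_single fun_upd_comp_perm; blast)

lemma permute_slots_ideal:
  fixes x :: "('n, ('k::comm_ring_1, 'm) mpoly) slots \<Rightarrow>\<^sub>0 'k"
  assumes "x \<in> ideal_generated multilinear_relations"
  shows "Poly_Mapping.map_key (permute_slots \<sigma>) x \<in> ideal_generated multilinear_relations"
  using assms
proof (induction rule: ring_module.span_induct_alt)
  case base
  show ?case
    by (simp add: map_key_zero[OF bij_is_inj[OF bij_permute_slots]] ring_module.span_zero)
next
  case (step c g y)
  then show ?case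
    by (simp add: map_key_plus[OF bij_is_inj[OF bij_permute_slots]]
        map_key_mult[OF bij_permute_slots permute_slots_add]
        ring_module.span_add ring_module.span_scale ring_module.span_base permute_slots_relations)
qed

text \<open>On pure tensors \<open>\<sigma>\<close> acts by \<open>v \<mapsto> v \<circ> \<sigma>\<inverse>\<close>.\<close>

lift_definition permute_tensor ::
    "'n perm \<Rightarrow> ('k::comm_ring_1, 'm, 'n) tensor_power \<Rightarrow> ('k, 'm, 'n) tensor_power"
  is "\<lambda>\<sigma>. Poly_Mapping.map_key (permute_slots \<sigma>)"
  using permute_slots_ideal
  by (fastforce simp: map_key_diff[OF bij_is_inj[OF bij_permute_slots], symmetric])

lemma permute_pure_tensor:
  "permute_tensor \<sigma> (pure_tensor v) = pure_tensor (v \<circ> Perm.apply (inverse \<sigma>))"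
  unfolding pure_tensor_def
  by transfer (simp add: map_key_permute_single ring_module.span_zero)

definition TS :: "('k::comm_ring_1, 'm, 'n::finite) tensor_power set" where
  "TS = {x. \<forall>\<sigma>. permute_tensor \<sigma> x = x}"

section \<open>The homomorphism attached to the determinant\<close>

text \<open>\<open>K\<close>-algebra homomorphisms \<open>TS\<^sup>n P \<rightarrow> A\<^sub>P\<close>, as functions on the carrier \<open>TS\<close>. The clause on
  constants gives \<open>\<alpha> 1 = 1\<close> and, with multiplicativity, \<open>K\<close>-linearity.\<close>

definition is_TS_hom ::
    "(('k::comm_ring_1, 'm, 'n::finite) tensor_power \<Rightarrow> ('k, 'm, 'n) AP) \<Rightarrow> bool" where
  "is_TS_hom \<alpha> \<longleftrightarrow>
     (\<forall>c. \<alpha> (tensor_const c) = AP_const c) \<and>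
     (\<forall>x\<in>TS. \<forall>y\<in>TS. \<alpha> (x + y) = \<alpha> x + \<alpha> y \<and> \<alpha> (x * y) = \<alpha> x * \<alpha> y)"

text \<open>Base change to \<open>S = K[t\<^sub>0, t\<^sub>1, \<dots>]\<close>. For a \<open>K\<close>-algebra \<open>B\<close>, the ring \<open>S \<otimes> B\<close> is \<open>B[t\<^sub>0, t\<^sub>1, \<dots>]\<close>, and the
  base change of a linear map acts on the coefficients. An \<open>f\<close> in \<open>S \<otimes> P\<close> is thus a polynomial
  in the \<open>t\<^sub>j\<close> with coefficients in \<open>P\<close>.\<close>

definition tensor_power_of ::
    "(('k::comm_ring_1, 'm) mpoly, nat) mpoly \<Rightarrow> (('k, 'm, 'n::finite) tensor_power, nat) mpoly" where
  "tensor_power_of f = (\<Prod>i\<in>UNIV. Poly_Mapping.map (slot_embedding i) f)"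

definition eval_base_change ::
    "(('k::comm_ring_1, 'm::finite) mpoly, nat) mpoly \<Rightarrow> (('k, 'm, 'n::finite) AP, nat) mpoly ^ 'n ^ 'n" where
  "eval_base_change f = (\<chi> i j. Poly_Mapping.map (\<lambda>p. eval_poly p $ i $ j) f)"

text \<open>\<open>\<alpha>\<close> corresponds to the multiplicative polynomial law \<open>det \<cdot> \<pi>\<^sub>P\<close>. It suffices to test the law over
  \<open>K[t\<^sub>0, t\<^sub>1, \<dots>]\<close>: for any commutative \<open>K\<close>-algebra \<open>S\<close>, an element \<open>\<Sum>\<^sub>j s\<^sub>j \<otimes> p\<^sub>j\<close> of \<open>S \<otimes> P\<close> is the
  image of \<open>\<Sum>\<^sub>j t\<^sub>j p\<^sub>j\<close> under \<open>t\<^sub>j \<mapsto> s\<^sub>j\<close>, and both sides of the law commute with this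
  specialization.\<close>

definition is_Roby_hom ::
    "(('k::comm_ring_1, 'm::finite, 'n::finite) tensor_power \<Rightarrow> ('k, 'm, 'n) AP) \<Rightarrow> bool" where
  "is_Roby_hom \<alpha> \<longleftrightarrow> is_TS_hom \<alpha> \<and>
     (\<forall>f. \<alpha> (pure_tensor (\<lambda>_. f)) = det (eval_poly f :: ('k, 'm, 'n) AP ^ 'n ^ 'n)) \<and>
     (\<forall>f. Poly_Mapping.map \<alpha> (tensor_power_of f) =
        det (eval_base_change f :: (('k, 'm, 'n) AP, nat) mpoly ^ 'n ^ 'n))"

end

theory Submission
  imports Defs
begin

text \<open>The key is that \<open>\<alpha>\<close> extends to a linear form on all of \<open>P\<^sup>\<otimes>\<^sup>n\<close>: let \<open>\<beta>\<close> (\<^verbatim>\<open>det_lift\<close>) send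
  \<open>f\<^sub>1 \<otimes> \<dots> \<otimes> f\<^sub>n\<close> to the determinant of the matrix whose \<open>i\<close>-th row is the \<open>i\<close>-th row of \<open>f\<^sub>i(\<xi>')\<close>.
  It is linear because the determinant is multilinear in the rows, and multiplicative on symmetric
  tensors because these act on the top exterior power.
  Specializing the \<open>\<xi>'\<^sub>k\<close> to diagonal matrices with entries \<open>1 \<otimes> \<dots> \<otimes> y\<^sub>k \<otimes> \<dots> \<otimes> 1\<close> turns \<open>\<beta>\<close> into the
  identity, whence injectivity.
  The coefficients of \<open>(t - f)\<^sup>\<otimes>\<^sup>n\<close> are elementary symmetric tensors, which \<open>\<beta>\<close> maps to
  the coefficients of characteristic polynomials. They generate \<open>TS\<^sup>n P\<close> as an algebra, by induction
  on the number of slots of an orbit of monomials that differ from \<open>1\<close>; this gives the image, and the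
  uniqueness of \<open>\<alpha>\<close> as well.\<close>

(* As a rewrite rule this is re-association to the left, which loops against mult_ac. *)
declare ring_module.scale_scale [simp del]

section \<open>Ring homomorphisms and monoid algebras\<close>

locale ring_map = additive h for h :: "'a::comm_ring_1 \<Rightarrow> 'b::comm_ring_1" +
  assumes mult: "h (x * y) = h x * h y" and one: "h 1 = 1"
begin

lemma prod: "h (prod f A) = (\<Prod>x\<in>A. h (f x))"
  by (induction A rule: infinite_finite_induct) (simp_all add: mult one)

lemma of_int: "h (of_int z) = of_int z"
proof -
  have nat: "h (of_nat k) = of_nat k" for k
    by (induction k) (simp_all add: add one zero)
  show ?thesis
    by (cases z rule: int_diff_cases) (simp add: diff nat)
qed

end

lemma ring_map_Const: "ring_map (Const :: 'k::comm_ring_1 \<Rightarrow> 'a::comm_monoid_add \<Rightarrow>\<^sub>0 'k)"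
  by unfold_locales (simp_all add: Const_def single_add mult_single)

text \<open>Values lie in a \<open>'k\<close>-algebra with structure map \<open>\<iota>\<close>,
  whereas \<open>linear_extension\<close> stays in the coefficient ring. Entries of evaluated
  polynomials, the diagonal specialization and functionals on tensors are all instances.\<close>

definition scalar_extension :: "('k::comm_ring_1 \<Rightarrow> 'r::comm_ring_1) \<Rightarrow> ('a \<Rightarrow> 'r) \<Rightarrow> ('a \<Rightarrow>\<^sub>0 'k) \<Rightarrow> 'r" where
  "scalar_extension \<iota> \<phi> p = (\<Sum>a\<in>Poly_Mapping.keys p. \<iota> (Poly_Mapping.lookup p a) * \<phi> a)"

context ring_map
begin

lemma scalar_extension_superset:
  assumes "finite A" "Poly_Mapping.keys p \<subseteq> A"
  shows "scalar_extension h \<phi> p = (\<Sum>a\<in>A. h (Poly_Mapping.lookup p a) * \<phi> a)"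
  unfolding scalar_extension_def using assms
  by (intro sum.mono_neutral_left) (auto simp: in_keys_iff zero)

lemma scalar_extension_single [simp]:
  "scalar_extension h \<phi> (Poly_Mapping.single a c) = h c * \<phi> a"
  by (cases "c = 0") (simp_all add: scalar_extension_def zero)

lemma additive_scalar_extension: "Modules.additive (scalar_extension h \<phi>)"
proof
  fix p q :: "'c \<Rightarrow>\<^sub>0 'a"
  let ?A = "Poly_Mapping.keys p \<union> Poly_Mapping.keys q"
  have "scalar_extension h \<phi> r = (\<Sum>a\<in>?A. h (Poly_Mapping.lookup r a) * \<phi> a)"
    if "r \<in> {p, q, p + q}" for r
    using that keys_add[of p q] by (intro scalar_extension_superset) auto
  then show "scalar_extension h \<phi> (p + q) = scalar_extension h \<phi> p + scalar_extension h \<phi> q"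
    by (simp add: lookup_add add ring_distribs sum.distrib)
qed

lemma ring_map_scalar_extension:
  fixes \<phi> :: "'c::comm_monoid_add \<Rightarrow> 'b"
  assumes "\<And>a b. \<phi> (a + b) = \<phi> a * \<phi> b" "\<phi> 0 = 1"
  shows "ring_map (scalar_extension h \<phi>)"
proof -
  interpret E: additive "scalar_extension h \<phi>" by (rule additive_scalar_extension)
  show ?thesis
  proof
    fix p q :: "'c \<Rightarrow>\<^sub>0 'a"
    show "scalar_extension h \<phi> (p * q) = scalar_extension h \<phi> p * scalar_extension h \<phi> q"
    proof (induction p rule: poly_mapping_additive_induct)
      case (single k v)
      show ?case
      proof (induction q rule: poly_mapping_additive_induct)
        case (single l w)
        show ?case by (simp add: mult_single assms mult mult_ac)
      qed (simp_all only: E.add E.zero ring_distribs mult_zero_right)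
    qed (simp_all only: E.add E.zero ring_distribs mult_zero_left)
    show "scalar_extension h \<phi> 1 = 1"
      using scalar_extension_single[of \<phi> 0 1] by (simp add: assms one)
  qed
qed

end

text \<open>Constants and variables generate the polynomial ring; a monomial is reached by splitting
  off one variable at a time.\<close>

lemma mpoly_induct [case_names const var add mult]:
  fixes p :: "('k::comm_ring_1, 'x) mpoly"
  assumes const: "\<And>c. P (Const c)" and var: "\<And>x. P (Var x)"
    and add: "\<And>p q. P p \<Longrightarrow> P q \<Longrightarrow> P (p + q)" and mult: "\<And>p q. P p \<Longrightarrow> P q \<Longrightarrow> P (p * q)"
  shows "P p"
proof (induction p rule: poly_mapping_additive_induct)
  case zero
  show ?case using const[of 0] by (simp add: Const_def)
next
  case (single \<mu> c)
  have "P (Poly_Mapping.single \<mu> 1)"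
  proof (induction \<mu> rule: poly_mapping_additive_induct)
    case zero
    show ?case using const[of 1] by (simp add: Const_def)
  next
    case (single x j)
    show ?case
    proof (induction j)
      case 0
      show ?case using const[of 1] by (simp add: Const_def)
    next
      case (Suc j)
      have "Poly_Mapping.single (Poly_Mapping.single x (Suc j)) 1 =
          Var x * Poly_Mapping.single (Poly_Mapping.single x j) (1 :: 'k)"
        by (simp add: Var_def mult_single flip: single_add)
      with mult[OF var Suc] show ?case by metis
    qed
  next
    case (add a b)
    from mult[OF this] show ?case by (simp add: mult_single)
  qed
  from mult[OF const[of c] this] show ?case by (simp add: Const_def mult_single)
qed (rule add)

section \<open>Coefficientwise maps and finite expansions\<close>

lemma lookup_map_zero:
  "f 0 = 0 \<Longrightarrow> Poly_Mapping.lookup (Poly_Mapping.map f p) k = f (Poly_Mapping.lookup p k)"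
  by (simp add: Poly_Mapping.map.rep_eq when_def)

lemma additive_poly_mapping_map:
  assumes "Modules.additive f"
  shows "Modules.additive (Poly_Mapping.map f :: ('a \<Rightarrow>\<^sub>0 'b::ab_group_add) \<Rightarrow> 'a \<Rightarrow>\<^sub>0 'c::ab_group_add)"
proof -
  interpret additive f by fact
  show ?thesis
    by standard (rule poly_mapping_eqI, simp add: lookup_map_zero zero lookup_add add)
qed

lemma ring_map_poly_mapping_map:
  assumes "ring_map f"
  shows "ring_map (Poly_Mapping.map f :: ('a::comm_monoid_add \<Rightarrow>\<^sub>0 'b::comm_ring_1) \<Rightarrow> 'a \<Rightarrow>\<^sub>0 'c::comm_ring_1)"
proof -
  interpret ring_map f by fact
  interpret M: additive "Poly_Mapping.map f :: ('a \<Rightarrow>\<^sub>0 'b) \<Rightarrow> 'a \<Rightarrow>\<^sub>0 'c"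
    by (rule additive_poly_mapping_map) unfold_locales
  show ?thesis
  proof
    fix p q :: "'a \<Rightarrow>\<^sub>0 'b"
    show "Poly_Mapping.map f (p * q) = Poly_Mapping.map f p * Poly_Mapping.map f q"
    proof (induction p rule: poly_mapping_additive_induct)
      case (single k v)
      show ?case
      proof (induction q rule: poly_mapping_additive_induct)
        case (single l w)
        show ?case by (simp add: mult_single mult zero)
      qed (simp_all only: M.add M.zero ring_distribs mult_zero_right)
    qed (simp_all only: M.add M.zero ring_distribs mult_zero_left)
    have "Poly_Mapping.map f (Poly_Mapping.single 0 1) = Poly_Mapping.single (0 :: 'a) (f 1)"
      by (rule map_single) (simp add: zero)
    then show "Poly_Mapping.map f (1 :: 'a \<Rightarrow>\<^sub>0 'b) = 1"
      by (simp add: one)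
  qed
qed

lemma sum_single_lookup:
  fixes p :: "'a \<Rightarrow>\<^sub>0 'b::comm_monoid_add"
  assumes "finite A" "Poly_Mapping.keys p \<subseteq> A"
  shows "(\<Sum>a\<in>A. Poly_Mapping.single a (Poly_Mapping.lookup p a)) = p"
proof (rule poly_mapping_eqI)
  fix k
  have "(\<Sum>a\<in>A. Poly_Mapping.lookup p a when a = k) = Poly_Mapping.lookup p k"
  proof (cases "k \<in> A")
    case True
    then show ?thesis using assms by (simp add: when_def sum.delta')
  next
    case False
    then have "Poly_Mapping.lookup p k = 0" using assms by (auto simp: in_keys_iff)
    with False assms show ?thesis by (simp add: when_def)
  qed
  then show "Poly_Mapping.lookup (\<Sum>a\<in>A. Poly_Mapping.single a (Poly_Mapping.lookup p a)) k =
      Poly_Mapping.lookup p k"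
    by (simp add: lookup_sum lookup_single)
qed

lemma prod_single:
  "(\<Prod>i\<in>A. Poly_Mapping.single (a i) (c i)) =
    Poly_Mapping.single (\<Sum>i\<in>A. a i :: 'a::comm_monoid_add) (\<Prod>i\<in>A. c i :: 'b::comm_ring_1)"
  by (induction A rule: infinite_finite_induct) (simp_all add: mult_single)

section \<open>Evaluation at the generic commuting matrices\<close>

lemma ring_map_AP_class: "ring_map AP_class"
proof
  show "AP_class 1 = 1" by transfer (rule ideal_eq_cong, rule refl)
qed (simp_all add: AP_class_add AP_class_mult)

interpretation AP_class: ring_map AP_class by (rule ring_map_AP_class)

lemma ring_map_AP_const: "ring_map AP_const"
proof -
  interpret C: ring_map "Const :: 'k::comm_ring_1 \<Rightarrow> ('k, 'b \<times> 'c \<times> 'c) mpoly"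
    by (rule ring_map_Const)
  show "ring_map (AP_const :: 'k \<Rightarrow> ('k, 'b, 'c::finite) AP)"
    by unfold_locales (simp_all add: AP_const_def C.add C.mult C.one AP_class.add AP_class.mult AP_class.one)
qed

interpretation AP_const: ring_map AP_const by (rule ring_map_AP_const)

text \<open>By associativity the start matrix factors out of the iteration. What remains, the
  iteration started at the identity, serves as the matrix power from here on.\<close>

lemma matrix_left_power:
  fixes X :: "'a::comm_ring_1 ^ 'n ^ 'n"
  shows "((**) X ^^ j) M = ((**) X ^^ j) (mat 1) ** M"
  by (induction j) (simp_all add: matrix_mul_assoc[symmetric])

lemma matrix_left_power_add:
  fixes X :: "'a::comm_ring_1 ^ 'n ^ 'n"
  shows "((**) X ^^ (a + b)) (mat 1) = ((**) X ^^ a) (mat 1) ** ((**) X ^^ b) (mat 1)"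
  by (simp add: funpow_add matrix_left_power[where M = "((**) X ^^ b) (mat 1)"])

lemma matrix_left_power_commute:
  fixes X :: "'a::comm_ring_1 ^ 'n ^ 'n"
  assumes "X ** Z = Z ** X"
  shows "((**) X ^^ j) (mat 1) ** Z = Z ** ((**) X ^^ j) (mat 1)"
proof (induction j)
  case (Suc j)
  have "X ** ((**) X ^^ j) (mat 1) ** Z = X ** Z ** ((**) X ^^ j) (mat 1)"
    by (simp add: Suc matrix_mul_assoc[symmetric])
  then show ?case by (simp add: assms matrix_mul_assoc)
qed simp

text \<open>The fold of \<open>eval_monomial\<close> over an arbitrary set of variables in place of
  \<open>UNIV\<close>, so that induction on finite sets applies.\<close>

definition partial_eval ::
    "'m set \<Rightarrow> ('m \<Rightarrow>\<^sub>0 nat) \<Rightarrow> ('k::comm_ring_1, 'm, 'n::finite) AP ^ 'n ^ 'n" where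
  "partial_eval A \<mu> =
     Finite_Set.fold (\<lambda>k M. (((**) (commuting_matrix k)) ^^ Poly_Mapping.lookup \<mu> k) M) (mat 1) A"

lemma partial_eval_empty [simp]: "partial_eval {} \<mu> = mat 1"
  by (simp add: partial_eval_def)

lemma partial_eval_insert:
  fixes \<mu> :: "'m \<Rightarrow>\<^sub>0 nat"
  assumes "finite A" "k \<notin> A"
  shows "(partial_eval (insert k A) \<mu> :: ('k::comm_ring_1, 'm, 'n::finite) AP ^ 'n ^ 'n) =
    ((**) (commuting_matrix k) ^^ Poly_Mapping.lookup \<mu> k) (mat 1) ** partial_eval A \<mu>"
proof -
  interpret comp_fun_commute "\<lambda>k M. (((**) (commuting_matrix k :: ('k, 'm, 'n) AP ^ 'n ^ 'n))
     ^^ Poly_Mapping.lookup \<mu> k) M" by (rule comp_fun_commute_eval)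
  show ?thesis
    unfolding partial_eval_def fold_insert[OF assms] by (rule matrix_left_power)
qed

lemma partial_eval_commute:
  assumes "finite A" "\<And>k. commuting_matrix k ** Z = Z ** commuting_matrix k"
  shows "partial_eval A \<mu> ** Z = Z ** partial_eval A \<mu>"
  using assms(1)
proof (induction A)
  case (insert k A)
  let ?X = "((**) (commuting_matrix k) ^^ Poly_Mapping.lookup \<mu> k) (mat 1)"
  have "?X ** partial_eval A \<mu> ** Z = ?X ** Z ** partial_eval A \<mu>"
    by (simp add: insert.IH matrix_mul_assoc[symmetric])
  then show ?case
    by (simp add: partial_eval_insert insert.hyps matrix_left_power_commute[OF assms(2)] matrix_mul_assoc)
qed simp

text \<open>The power contributed by a new variable has to pass the product over the earlier ones;
  it does because the generic commuting matrices commute.\<close>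

lemma partial_eval_add:
  fixes a b :: "'m \<Rightarrow>\<^sub>0 nat"
  assumes "finite A"
  shows "(partial_eval A (a + b) :: ('k::comm_ring_1, 'm, 'n::finite) AP ^ 'n ^ 'n) = partial_eval A a ** partial_eval A b"
  using assms
proof (induction A)
  case (insert k A)
  let ?X = "\<lambda>j. ((**) (commuting_matrix k :: ('k, 'm, 'n) AP ^ 'n ^ 'n) ^^ j) (mat 1)"
  have "partial_eval A a ** ?X (Poly_Mapping.lookup b k) = ?X (Poly_Mapping.lookup b k) ** partial_eval A a"
    by (rule partial_eval_commute[OF insert.hyps(1)])
      (rule matrix_left_power_commute[OF commuting_matrix_commute, symmetric])
  then have *: "?X (Poly_Mapping.lookup a k) ** (?X (Poly_Mapping.lookup b k) ** partial_eval A a) ** partial_eval A b =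
      ?X (Poly_Mapping.lookup a k) ** (partial_eval A a ** ?X (Poly_Mapping.lookup b k)) ** partial_eval A b"
    by (simp only:)
  show ?case
    by (simp add: *[unfolded matrix_mul_assoc] partial_eval_insert insert lookup_add matrix_left_power_add matrix_mul_assoc)
qed simp

lemma partial_eval_UNIV: "partial_eval UNIV \<mu> = eval_monomial \<mu>"
  by (simp add: partial_eval_def eval_monomial_def)

lemma eval_monomial_add: "eval_monomial (a + b) = eval_monomial a ** eval_monomial b"
  unfolding partial_eval_UNIV[symmetric] by (rule partial_eval_add) simp

lemma eval_monomial_zero: "eval_monomial (0 :: 'm::finite \<Rightarrow>\<^sub>0 nat) =
    (mat 1 :: ('k::comm_ring_1, 'm, 'n::finite) AP ^ 'n ^ 'n)"
proof -
  have "partial_eval A 0 = (mat 1 :: ('k, 'm, 'n) AP ^ 'n ^ 'n)" if "finite A" for A :: "'m set"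
    using that by induction (simp_all add: partial_eval_insert)
  from this[of UNIV] show ?thesis by (simp add: partial_eval_UNIV)
qed

lemma mat_mult_component:
  fixes M :: "'a::comm_ring_1 ^ 'n ^ 'n"
  shows "(mat c ** M) $ i $ j = c * (M $ i $ j)"
proof -
  have "(\<Sum>k\<in>UNIV. (if i = k then c else 0) * M $ k $ j) = (\<Sum>k\<in>UNIV. if k = i then c * M $ i $ j else 0)"
    by (rule sum.cong) auto
  then show ?thesis by (simp add: matrix_matrix_mult_def mat_def)
qed


lemma eval_poly_component:
  "eval_poly f $ i $ j = scalar_extension AP_const (\<lambda>\<mu>. eval_monomial \<mu> $ i $ j) f"
  by (simp only: eval_poly_def scalar_extension_def mat_mult_component sum_component)

lemma eval_poly_add: "eval_poly (f + g) = eval_poly f + eval_poly g"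
  by (simp add: vec_eq_iff eval_poly_component Modules.additive.add[OF AP_const.additive_scalar_extension])

lemma eval_poly_single: "eval_poly (Poly_Mapping.single \<mu> c) = mat (AP_const c) ** eval_monomial \<mu>"
  by (simp add: vec_eq_iff eval_poly_component mat_mult_component)

lemma additive_eval_poly: "Modules.additive eval_poly"
  by standard (rule eval_poly_add)

lemma mat_mult_mat_mult:
  fixes M N :: "'a::comm_ring_1 ^ 'n ^ 'n"
  shows "(mat c ** M) ** (mat d ** N) = mat (c * d) ** (M ** N)"
  by (simp add: vec_eq_iff mat_mult_component matrix_matrix_mult_def[of "mat c ** M"]
      matrix_matrix_mult_def[of M] sum_distrib_left mult_ac)

text \<open>Both sides are biadditive, so single terms suffice; there exponents add and scalar
  matrices are central.\<close>

lemma eval_poly_mult: "eval_poly (f * g) = eval_poly f ** eval_poly g"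
proof (induction f rule: poly_mapping_additive_induct)
  case (single \<mu> c)
  show ?case
  proof (induction g rule: poly_mapping_additive_induct)
    case (single \<nu> d)
    show ?case
      by (simp add: mult_single eval_poly_single eval_monomial_add AP_const.mult mat_mult_mat_mult)
  qed (simp_all add: Modules.additive.zero[OF additive_eval_poly] eval_poly_add ring_distribs matrix_add_ldistrib)
qed (simp_all add: Modules.additive.zero[OF additive_eval_poly] eval_poly_add matrix_matrix_mult_def vec_eq_iff sum.distrib ring_distribs)

lemma eval_poly_Const: "eval_poly (Const c) = mat (AP_const c)"
  by (simp add: Const_def eval_poly_single eval_monomial_zero)

lemma eval_poly_one: "eval_poly 1 = mat 1"
  using eval_poly_Const[of 1] by (simp add: Const_def AP_const.one)

lemma eval_poly_Const_mult: "eval_poly (Const c * f) $ i $ j = AP_const c * (eval_poly f $ i $ j)"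
  by (simp add: eval_poly_mult eval_poly_Const mat_mult_component)


section \<open>Tensor powers\<close>

lemma tensor_class_eq_iff:
  "tensor_class p = tensor_class q \<longleftrightarrow> p - q \<in> ideal_generated multilinear_relations"
  by transfer (rule refl)

lemma tensor_class_surj: "\<exists>p. x = tensor_class p"
  by transfer (rule exI, rule ideal_eq_cong, rule refl)

lemma ring_map_tensor_class: "ring_map tensor_class"
proof
  show "tensor_class (p + q) = tensor_class p + tensor_class q" for p q
    by transfer (rule ideal_eq_cong, rule refl)
  show "tensor_class (p * q) = tensor_class p * tensor_class q" for p q
    by transfer (rule ideal_eq_cong, rule refl)
  show "tensor_class 1 = 1" by transfer (rule ideal_eq_cong, rule refl)
qed

interpretation tensor_class: ring_map tensor_class by (rule ring_map_tensor_class)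

lemma ring_map_tensor_const: "ring_map tensor_const"
proof -
  interpret C: ring_map "Const :: 'k::comm_ring_1 \<Rightarrow> ('c, ('k, 'b) mpoly) slots \<Rightarrow>\<^sub>0 'k"
    by (rule ring_map_Const)
  show "ring_map (tensor_const :: 'k \<Rightarrow> ('k, 'b, 'c::finite) tensor_power)"
    by unfold_locales
      (simp_all add: tensor_const_def C.add C.mult C.one tensor_class.add tensor_class.mult tensor_class.one)
qed

interpretation tensor_const: ring_map tensor_const by (rule ring_map_tensor_const)

lemma tensor_class_single:
  "tensor_class (Poly_Mapping.single (Slots v) c) = tensor_const c * pure_tensor v"
  by (simp add: tensor_const_def pure_tensor_def Const_def mult_single flip: tensor_class.mult)

text \<open>Pure tensors span the tensor power over \<open>'k\<close>. The scalar is part of the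
  base case, so that closure under sums suffices.\<close>

lemma tensor_induct [case_names pure add]:
  assumes pure: "\<And>c v. P (tensor_const c * pure_tensor v)"
    and add: "\<And>x y. P x \<Longrightarrow> P y \<Longrightarrow> P (x + y)"
  shows "P x"
proof -
  obtain p where "x = tensor_class p" using tensor_class_surj by blast
  moreover have "P (tensor_class p)"
  proof (induction p rule: poly_mapping_additive_induct)
    case zero
    show ?case using pure[of 0] by (simp add: tensor_const.zero tensor_class.zero)
  next
    case (single s c)
    show ?case using pure[of c "slot s"] by (simp flip: tensor_class_single)
  next
    case (add p q)
    then show ?case by (simp add: tensor_class.add assms(2))
  qed
  ultimately show ?thesis by simp
qed

lemma pure_tensor_mult: "pure_tensor u * pure_tensor v = pure_tensor (\<lambda>i. u i * v i)"
  by (simp add: pure_tensor_def mult_single plus_slots_def flip: tensor_class.mult)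

lemma pure_tensor_one: "pure_tensor (\<lambda>_. 1) = 1"
  by (simp add: pure_tensor_def tensor_class.one flip: zero_slots_def)

lemma tensor_class_relation: "g \<in> multilinear_relations \<Longrightarrow> tensor_class g = 0"
  using tensor_class_eq_iff[of g 0] by (simp add: tensor_class.zero ring_module.span_base)

lemma pure_tensor_upd_add:
  "pure_tensor (v(i := a + b)) = pure_tensor (v(i := a)) + pure_tensor (v(i := b))"
proof -
  have "tensor_class (Poly_Mapping.single (Slots (v(i := a + b))) 1
        - Poly_Mapping.single (Slots (v(i := a))) 1
        - Poly_Mapping.single (Slots (v(i := b))) 1) = 0"
    by (rule tensor_class_relation) (unfold multilinear_relations_def, blast)
  then show ?thesis by (simp add: pure_tensor_def tensor_class.diff tensor_class.add algebra_simps)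
qed

lemma pure_tensor_upd_Const_mult:
  "pure_tensor (v(i := Const c * a)) = tensor_const c * pure_tensor (v(i := a))"
proof -
  have "tensor_class (Poly_Mapping.single (Slots (v(i := Const c * a))) 1
        - Poly_Mapping.single (Slots (v(i := a))) c) = 0"
    by (rule tensor_class_relation) (unfold multilinear_relations_def, blast)
  then show ?thesis by (simp add: tensor_class.diff tensor_class_single tensor_const.one)
qed

lemma ring_map_slot_embedding: "ring_map (slot_embedding i)"
proof
  show "slot_embedding i (f + g) = slot_embedding i f + slot_embedding i g" for f g
    by (simp add: slot_embedding_def pure_tensor_upd_add)
  show "slot_embedding i (f * g) = slot_embedding i f * slot_embedding i g" for f g
    unfolding slot_embedding_def pure_tensor_mult
    by (rule arg_cong[of _ _ pure_tensor]) auto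
  show "slot_embedding i 1 = 1"
    by (simp add: slot_embedding_def fun_upd_def pure_tensor_one)
qed

lemma slot_embedding_Const: "slot_embedding i (Const c) = tensor_const c"
  using pure_tensor_upd_Const_mult[of "\<lambda>_. 1" i c 1]
  by (simp add: slot_embedding_def fun_upd_idem pure_tensor_one)

lemma prod_slot_embedding:
  "(\<Prod>i\<in>A. slot_embedding i (v i)) = pure_tensor (\<lambda>i. if i \<in> A then v i else 1)"
proof (induction A rule: infinite_finite_induct)
  case (insert j A)
  then show ?case
    by (auto simp: slot_embedding_def pure_tensor_mult intro!: arg_cong[of _ _ pure_tensor])
qed (simp_all add: pure_tensor_one)

lemma pure_tensor_eq_prod: "pure_tensor v = (\<Prod>i\<in>UNIV. slot_embedding i (v i))"
  by (simp add: prod_slot_embedding)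

subsection \<open>Functionals on tensor powers\<close>

text \<open>The functional that multiplies the values of the \<open>g i\<close> on pure tensors. It
  is read off at a chosen representative, because independence of the choice
  (\<open>tensor_lift_class\<close>) rests on the linearity of each \<open>g i\<close>, which is
  only assumed in the locale below.\<close>

definition tensor_lift ::
    "('k::comm_ring_1 \<Rightarrow> 'r::comm_ring_1) \<Rightarrow> ('n \<Rightarrow> ('k, 'm) mpoly \<Rightarrow> 'r) \<Rightarrow> ('k, 'm, 'n::finite) tensor_power \<Rightarrow> 'r" where
  "tensor_lift \<iota> g x =
     scalar_extension \<iota> (\<lambda>s. \<Prod>i\<in>UNIV. g i (slot s i)) (SOME p. x = tensor_class p)"

locale tensor_functional = ring_map \<iota> for \<iota> :: "'k::comm_ring_1 \<Rightarrow> 'r::comm_ring_1" +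
  fixes g :: "'n::finite \<Rightarrow> ('k, 'm) mpoly \<Rightarrow> 'r"
  assumes g_add: "g i (a + b) = g i a + g i b"
    and g_scale: "g i (Const c * a) = \<iota> c * g i a"
begin

abbreviation (input) L :: "(('n, ('k, 'm) mpoly) slots \<Rightarrow>\<^sub>0 'k) \<Rightarrow> 'r" where
  "L \<equiv> scalar_extension \<iota> (\<lambda>s. \<Prod>i\<in>UNIV. g i (slot s i))"

sublocale L: additive L by (rule additive_scalar_extension)

lemma prod_upd:
  "(\<Prod>j\<in>UNIV. g j ((v(i := a)) j)) = g i a * (\<Prod>j\<in>UNIV - {i}. g j (v j))"
  by (subst prod.remove[of UNIV i]) (auto intro!: prod.cong arg_cong2[of _ _ _ _ "(*)"])

lemma plus_Slots_upd:
  fixes w :: "('n, ('k, 'm) mpoly) slots"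
  shows "w + Slots (v(i := a)) = Slots ((\<lambda>j. slot w j * v j)(i := slot w i * a))"
  by (auto simp: plus_slots_def)

text \<open>The quotient is by an ideal but \<open>L\<close> is merely linear, so vanishing on the
  relations alone would not suffice. A family times a relation is again a multiple of a relation,
  its varying slot being multiplied by \<open>slot w i\<close>, and linearity in slot
  \<open>i\<close> applies.\<close>

lemma L_single_mult_relation:
  assumes "r \<in> multilinear_relations"
  shows "L (Poly_Mapping.single w c * r) = 0"
proof -
  have "L (Poly_Mapping.single w c * (Poly_Mapping.single (Slots (v(i := a + b))) 1
        - Poly_Mapping.single (Slots (v(i := a))) 1
        - Poly_Mapping.single (Slots (v(i := b))) 1)) = 0" for v i a b
    unfolding right_diff_distrib mult_single plus_Slots_upd L.diff scalar_extension_single slots.sel prod_upd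
    by (simp add: ring_distribs g_add)
  moreover have "L (Poly_Mapping.single w c * (Poly_Mapping.single (Slots (v(i := Const d * a))) 1
        - Poly_Mapping.single (Slots (v(i := a))) d)) = 0" for v i a d
    unfolding right_diff_distrib mult_single plus_Slots_upd L.diff scalar_extension_single slots.sel prod_upd
      mult.left_commute[of "slot w i" "Const d"]
    by (simp add: g_scale mult mult.assoc)
  ultimately show ?thesis
    using assms unfolding multilinear_relations_def by blast
qed

lemma L_ideal:
  assumes "x \<in> ideal_generated multilinear_relations"
  shows "L x = 0"
  using assms
proof (induction rule: ring_module.span_induct_alt)
  case base
  show ?case by (rule L.zero)
next
  case (step c r y)
  have "L (c * r) = 0"
    by (induction c rule: poly_mapping_additive_induct)
      (simp_all only: mult_zero_left distrib_right L.add L.zero L_single_mult_relation[OF step(1)] add_0)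
  with step show ?case by (simp only: L.add add_0)
qed

lemma tensor_lift_class: "tensor_lift \<iota> g (tensor_class p) = L p"
proof -
  let ?q = "SOME q. tensor_class p = tensor_class q"
  have "tensor_class p = tensor_class ?q" by (rule someI) (rule refl)
  then have "L (p - ?q) = 0" by (intro L_ideal) (simp only: tensor_class_eq_iff)
  then show ?thesis by (simp add: tensor_lift_def L.diff)
qed

lemma tensor_lift_add: "tensor_lift \<iota> g (x + y) = tensor_lift \<iota> g x + tensor_lift \<iota> g y"
proof -
  obtain p q where "x = tensor_class p" "y = tensor_class q" using tensor_class_surj by metis
  then show ?thesis
    by (simp add: tensor_lift_class L.add flip: tensor_class.add)
qed

sublocale lift: additive "tensor_lift \<iota> g"
  by standard (rule tensor_lift_add)

lemma tensor_lift_pure: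
  "tensor_lift \<iota> g (tensor_const c * pure_tensor v) = \<iota> c * (\<Prod>i\<in>UNIV. g i (v i))"
  by (simp add: tensor_lift_class flip: tensor_class_single)

lemma tensor_lift_pure_tensor: "tensor_lift \<iota> g (pure_tensor v) = (\<Prod>i\<in>UNIV. g i (v i))"
  using tensor_lift_pure[of 1 v] by (simp add: one tensor_const.one)

lemma tensor_lift_scale: "tensor_lift \<iota> g (tensor_const c * x) = \<iota> c * tensor_lift \<iota> g x"
proof (induction x rule: tensor_induct)
  case (pure d v)
  show ?case
    using tensor_lift_pure[of "c * d" v] by (simp add: tensor_lift_pure tensor_const.mult mult mult.assoc)
qed (simp add: ring_distribs lift.add)

text \<open>Expand every factor into single terms; then both sides are sums over all choices of terms.\<close>

lemma map_tensor_lift_prod: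
  fixes F :: "'n \<Rightarrow> (('k, 'm) mpoly, nat) mpoly"
  shows "Poly_Mapping.map (tensor_lift \<iota> g) (\<Prod>i\<in>UNIV. Poly_Mapping.map (slot_embedding i) (F i)) =
    (\<Prod>i\<in>UNIV. Poly_Mapping.map (g i) (F i))"
proof -
  interpret M: additive "Poly_Mapping.map (tensor_lift \<iota> g) :: ((nat \<Rightarrow>\<^sub>0 nat) \<Rightarrow>\<^sub>0 _) \<Rightarrow> _"
    by (rule additive_poly_mapping_map) (rule lift.additive_axioms)
  \<comment> \<open>All slots are expanded over one common finite set of exponents, so that a choice
    of terms is a function from the slots to \<open>K\<close>.\<close>
  define K where "K = (\<Union>i\<in>UNIV. Poly_Mapping.keys (F i))"
  have K: "finite K" by (simp add: K_def)
  have expand: "(\<Prod>i\<in>UNIV. Poly_Mapping.map (h i) (F i)) =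
      (\<Sum>\<kappa>\<in>UNIV \<rightarrow>\<^sub>E K. Poly_Mapping.single (\<Sum>i\<in>UNIV. \<kappa> i) (\<Prod>i\<in>UNIV. h i (Poly_Mapping.lookup (F i) (\<kappa> i))))"
    if h: "\<And>i. Modules.additive (h i)" for h :: "'n \<Rightarrow> ('k, 'm) mpoly \<Rightarrow> 's::comm_ring_1"
  proof -
    have "Poly_Mapping.map (h i) (F i) =
        (\<Sum>k\<in>K. Poly_Mapping.single k (h i (Poly_Mapping.lookup (F i) k)))" for i
    proof -
      interpret additive "h i" by (rule h)
      have "Poly_Mapping.keys (Poly_Mapping.map (h i) (F i)) \<subseteq> K"
        by (auto simp: K_def in_keys_iff lookup_map_zero zero) (metis zero)
      from sum_single_lookup[OF K this] show ?thesis by (simp add: lookup_map_zero zero)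
    qed
    then show ?thesis
      by (simp add: prod_sum_PiE K prod_single)
  qed
  have emb: "Modules.additive (slot_embedding i :: _ \<Rightarrow> ('k, 'm, 'n) tensor_power)" for i
    using ring_map_slot_embedding ring_map.axioms(1) by blast
  have "Modules.additive (g i)" for i by standard (rule g_add)
  note expand[of g, OF this]
  \<comment> \<open>On the tensor side the product of the embedded coefficients is a pure tensor,
    where the functional is the product of the \<open>g i\<close>.\<close>
  moreover have "Poly_Mapping.map (tensor_lift \<iota> g) (\<Prod>i\<in>UNIV. Poly_Mapping.map (slot_embedding i) (F i)) =
    (\<Sum>\<kappa>\<in>UNIV \<rightarrow>\<^sub>E K. Poly_Mapping.single (\<Sum>i\<in>UNIV. \<kappa> i) (\<Prod>i\<in>UNIV. g i (Poly_Mapping.lookup (F i) (\<kappa> i))))"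
    unfolding expand[of slot_embedding, OF emb] M.sum
    by (simp add: lift.zero tensor_lift_pure_tensor flip: pure_tensor_eq_prod)
  ultimately show ?thesis by simp
qed

end

subsection \<open>Symmetric tensors\<close>

lemma permute_tensor_add: "permute_tensor \<sigma> (x + y) = permute_tensor \<sigma> x + permute_tensor \<sigma> y"
  by transfer (simp add: map_key_plus[OF bij_is_inj[OF bij_permute_slots]] ring_module.span_zero)

lemma permute_tensor_mult: "permute_tensor \<sigma> (x * y) = permute_tensor \<sigma> x * permute_tensor \<sigma> y"
  by transfer (simp add: map_key_mult[OF bij_permute_slots permute_slots_add] ring_module.span_zero)

lemma ring_map_permute_tensor: "ring_map (permute_tensor \<sigma>)"
proof
  show "permute_tensor \<sigma> 1 = 1"
    unfolding pure_tensor_one[symmetric] permute_pure_tensor by (simp add: o_def)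
qed (simp_all add: permute_tensor_add permute_tensor_mult)

interpretation permute_tensor: ring_map "permute_tensor \<sigma>" for \<sigma>
  by (rule ring_map_permute_tensor)

lemma permute_slot_embedding:
  "permute_tensor \<sigma> (slot_embedding i f) = slot_embedding (Perm.apply \<sigma> i) f"
  unfolding slot_embedding_def permute_pure_tensor fun_upd_comp_perm by (simp add: o_def)

lemma permute_tensor_const: "permute_tensor \<sigma> (tensor_const c) = tensor_const c"
  using permute_slot_embedding[of \<sigma> undefined "Const c"] by (simp only: slot_embedding_Const)

lemma TS_add: "x \<in> TS \<Longrightarrow> y \<in> TS \<Longrightarrow> x + y \<in> TS"
  and TS_diff: "x \<in> TS \<Longrightarrow> y \<in> TS \<Longrightarrow> x - y \<in> TS"
  and TS_mult: "x \<in> TS \<Longrightarrow> y \<in> TS \<Longrightarrow> x * y \<in> TS"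
  and TS_const: "tensor_const c \<in> TS"
  by (simp_all add: TS_def permute_tensor.add permute_tensor.diff permute_tensor.mult permute_tensor_const)

text \<open>A permutation of the slots only reorders the factors of the product, and it acts
  coefficientwise, so each coefficient is fixed.\<close>

lemma tensor_power_of_in_TS:
  fixes f :: "(('k::comm_ring_1, 'm) mpoly, nat) mpoly"
  shows "Poly_Mapping.lookup (tensor_power_of f) k \<in> (TS :: ('k, 'm, 'n::finite) tensor_power set)"
proof -
  have "Poly_Mapping.map (permute_tensor \<sigma>) (tensor_power_of f) = tensor_power_of f"
    for \<sigma> :: "'n perm"
  proof -
    interpret M: ring_map "Poly_Mapping.map (permute_tensor \<sigma>) :: ((nat \<Rightarrow>\<^sub>0 nat) \<Rightarrow>\<^sub>0 _) \<Rightarrow> _"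
      by (rule ring_map_poly_mapping_map) (rule ring_map_permute_tensor)
    have "Poly_Mapping.map (permute_tensor \<sigma>) (Poly_Mapping.map (slot_embedding i) f) =
        Poly_Mapping.map (slot_embedding (Perm.apply \<sigma> i)) f" for i
    proof -
      interpret S: ring_map "slot_embedding j" for j by (rule ring_map_slot_embedding)
      show ?thesis
        by (rule poly_mapping_eqI) (simp add: lookup_map_zero S.zero permute_tensor.zero permute_slot_embedding)
    qed
    then have "Poly_Mapping.map (permute_tensor \<sigma>) (tensor_power_of f) =
        (\<Prod>i\<in>UNIV. Poly_Mapping.map (slot_embedding (Perm.apply \<sigma> i)) f)"
      by (simp add: tensor_power_of_def M.prod)
    also have "\<dots> = tensor_power_of f"
      unfolding tensor_power_of_def
      by (rule prod.reindex_bij_betw[of "Perm.apply \<sigma>"]) (rule bij_apply)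
    finally show ?thesis .
  qed
  from this[THEN arg_cong[of _ _ "\<lambda>p. Poly_Mapping.lookup p k"]] show ?thesis
    by (simp add: TS_def lookup_map_zero permute_tensor.zero)
qed

text \<open>On a finite type every bijection has finite support. This links the type of
  permutations, used in \<open>TS\<close>, with the predicate \<open>permutes\<close>, used in
  determinants.\<close>

lemma apply_surj:
  assumes "p permutes (UNIV :: 'n::finite set)"
  obtains \<sigma> where "Perm.apply \<sigma> = p"
proof
  show "Perm.apply (Perm p) = p"
    by (rule Perm_inverse) (simp add: permutes_bij[OF assms])
qed


section \<open>The determinant as a linear form on the tensor power\<close>

text \<open>Let V be the free module of rank n over \<open>AP\<close>. A tensor acts on the n-th
  tensor power of V, its factor \<open>i\<close> through \<open>eval_poly\<close> on the
  \<open>i\<close>-th copy. Basis vectors of this power are indexed by functions on the slots; this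
  is the entry of the action in row \<open>u\<close> and column \<open>w\<close>.\<close>

definition matrix_entry :: "('n \<Rightarrow> 'n) \<Rightarrow> ('n \<Rightarrow> 'n) \<Rightarrow>
    ('k::comm_ring_1, 'm::finite, 'n::finite) tensor_power \<Rightarrow> ('k, 'm, 'n) AP" where
  "matrix_entry u w = tensor_lift AP_const (\<lambda>i f. eval_poly f $ u i $ w i)"

interpretation entry: tensor_functional AP_const
    "\<lambda>i f. (eval_poly f :: ('k::comm_ring_1, 'm::finite, 'n::finite) AP ^ 'n ^ 'n) $ u i $ w i"
  for u w :: "'n::finite \<Rightarrow> 'n"
  by unfold_locales (simp_all add: eval_poly_add eval_poly_Const_mult)

interpretation matrix_entry: additive "matrix_entry u w" for u w
  unfolding matrix_entry_def by (rule entry.lift.additive_axioms)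

lemma matrix_entry_scale: "matrix_entry u w (tensor_const c * x) = AP_const c * matrix_entry u w x"
  unfolding matrix_entry_def by (rule entry.tensor_lift_scale)

lemma matrix_entry_pure_tensor:
  "matrix_entry u w (pure_tensor v) = (\<Prod>i\<in>UNIV. eval_poly (v i) $ u i $ w i)"
  unfolding matrix_entry_def by (rule entry.tensor_lift_pure_tensor)

lemma map_matrix_entry_tensor_power_of:
  "Poly_Mapping.map (matrix_entry u w) (tensor_power_of f) =
    (\<Prod>i\<in>UNIV. Poly_Mapping.map (\<lambda>p. eval_poly p $ u i $ w i) f)"
  unfolding matrix_entry_def tensor_power_of_def by (rule entry.map_tensor_lift_prod)

text \<open>The action is multiplicative. Multiplying out the slotwise matrix products leaves one
  summation index per slot, and together these form the function \<open>z\<close>.\<close>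

lemma matrix_entry_mult:
  fixes u w :: "'n::finite \<Rightarrow> 'n"
  shows "matrix_entry u w (x * y) = (\<Sum>z\<in>UNIV. matrix_entry u z x * matrix_entry z w y)"
proof (induction x rule: tensor_induct)
  case (pure c a)
  show ?case
  proof (induction y rule: tensor_induct)
    case (pure d b)
    have eq: "tensor_const c * pure_tensor a * (tensor_const d * pure_tensor b) =
        tensor_const (c * d) * pure_tensor (\<lambda>i. a i * b i)"
      by (simp add: tensor_const.mult mult_ac flip: pure_tensor_mult)
    have "(\<Prod>i\<in>UNIV. eval_poly (a i * b i) $ u i $ w i) =
        (\<Sum>z\<in>UNIV. (\<Prod>i\<in>UNIV. eval_poly (a i) $ u i $ z i) * (\<Prod>i\<in>UNIV. eval_poly (b i) $ z i $ w i))"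
      by (simp add: eval_poly_mult matrix_matrix_mult_def prod_sum_PiE prod.distrib)
    then have "matrix_entry u w (tensor_const (c * d) * pure_tensor (\<lambda>i. a i * b i)) =
        (\<Sum>z\<in>UNIV. matrix_entry u z (tensor_const c * pure_tensor a) * matrix_entry z w (tensor_const d * pure_tensor b))"
      unfolding matrix_entry_scale matrix_entry_pure_tensor AP_const.mult
      by (simp add: sum_distrib_left mult_ac)
    then show ?case unfolding eq .
  next
    case (add y z)
    then show ?case by (simp add: matrix_entry.add ring_distribs sum.distrib)
  qed
next
  case (add x y)
  then show ?case by (simp add: matrix_entry.add ring_distribs sum.distrib)
qed

lemma matrix_entry_permute:
  "matrix_entry u w (permute_tensor \<sigma> y) = matrix_entry (u \<circ> Perm.apply \<sigma>) (w \<circ> Perm.apply \<sigma>) y"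
proof (induction y rule: tensor_induct)
  case (pure c v)
  have "(\<Prod>i\<in>UNIV. eval_poly ((v \<circ> Perm.apply (inverse \<sigma>)) i) $ u i $ w i) =
      (\<Prod>i\<in>UNIV. eval_poly ((v \<circ> Perm.apply (inverse \<sigma>)) (Perm.apply \<sigma> i)) $ u (Perm.apply \<sigma> i) $ w (Perm.apply \<sigma> i))"
    by (rule prod.reindex_bij_betw[symmetric]) (rule bij_apply)
  also have "\<dots> = (\<Prod>i\<in>UNIV. eval_poly (v i) $ (u \<circ> Perm.apply \<sigma>) i $ (w \<circ> Perm.apply \<sigma>) i)"
    by (simp add: Perm.apply_inverse bij_is_inj)
  finally show ?case
    by (simp only: permute_tensor.mult permute_tensor_const permute_pure_tensor matrix_entry_scale
        matrix_entry_pure_tensor)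
qed (simp add: permute_tensor.add matrix_entry.add)

text \<open>The action of a symmetric tensor commutes with the permutations of the factors; in
  coordinates, row and column index may be relabelled simultaneously.\<close>

lemma matrix_entry_TS:
  fixes p :: "'n::finite \<Rightarrow> 'n"
  assumes "y \<in> TS" "p permutes UNIV"
  shows "matrix_entry (u \<circ> p) (w \<circ> p) y = matrix_entry u w y"
proof -
  obtain \<sigma> where "Perm.apply \<sigma> = p" using apply_surj assms(2) by blast
  then show ?thesis
    using matrix_entry_permute[of u w \<sigma> y] assms(1) by (simp add: TS_def)
qed

text \<open>The Leibniz formula with \<open>matrix_entry id p\<close> in place of the product of the
  entries along \<open>p\<close>, hence defined and linear on the whole tensor power.\<close>

definition det_lift :: "('k::comm_ring_1, 'm::finite, 'n::finite) tensor_power \<Rightarrow> ('k, 'm, 'n) AP" where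
  "det_lift x = (\<Sum>p | p permutes (UNIV :: 'n set). of_int (sign p) * matrix_entry id p x)"

lemma det_lift_add: "det_lift (x + y) = det_lift x + det_lift y"
  by (simp add: det_lift_def matrix_entry.add ring_distribs sum.distrib)

interpretation det_lift: additive det_lift
  by standard (rule det_lift_add)

lemma det_lift_scale: "det_lift (tensor_const c * x) = AP_const c * det_lift x"
  unfolding det_lift_def matrix_entry_scale sum_distrib_left by (simp only: mult.left_commute)

lemma det_lift_pure_tensor: "det_lift (pure_tensor (\<lambda>_. f)) = det (eval_poly f)"
  by (simp add: det_lift_def det_def matrix_entry_pure_tensor)

lemma det_lift_one: "det_lift 1 = 1"
  using det_lift_pure_tensor[of 1] by (simp add: pure_tensor_one eval_poly_one)

lemma det_lift_const: "det_lift (tensor_const c) = AP_const c"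
  using det_lift_scale[of c 1] by (simp add: det_lift_one)

text \<open>Substituting \<open>p \<circ> z\<close> for \<open>p\<close> gives both indices the
  common factor \<open>z\<close>, which the symmetry of \<open>y\<close> removes. The price is the
  sign of \<open>z\<close>, as when the rows of a determinant are permuted.\<close>

lemma row_sum_TS_permutes:
  fixes z :: "'n::finite \<Rightarrow> 'n"
  assumes "y \<in> TS" "z permutes UNIV"
  shows "(\<Sum>p | p permutes UNIV. of_int (sign p) * matrix_entry z p y) = of_int (sign z) * det_lift y"
proof -
  have "(\<Sum>p | p permutes UNIV. of_int (sign p) * matrix_entry z p y) =
      (\<Sum>p | p permutes UNIV. of_int (sign (p \<circ> z)) * matrix_entry (id \<circ> z) (p \<circ> z) y)"
    using sum_permutations_compose_right[OF assms(2), of "\<lambda>p. of_int (sign p) * matrix_entry z p y"]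
    by simp
  also have "\<dots> = (\<Sum>p | p permutes UNIV. of_int (sign z) * (of_int (sign p) * matrix_entry id p y))"
  proof (rule sum.cong[OF refl])
    fix p :: "'n \<Rightarrow> 'n"
    assume "p \<in> {p. p permutes UNIV}"
    then have "sign (p \<circ> z) = sign p * sign z"
      using assms(2) by (intro sign_compose) (auto intro: permutes_imp_permutation[of UNIV])
    then show "of_int (sign (p \<circ> z)) * matrix_entry (id \<circ> z) (p \<circ> z) y =
        of_int (sign z) * (of_int (sign p) * matrix_entry id p y)"
      unfolding matrix_entry_TS[OF assms] by (simp add: mult_ac)
  qed
  finally show ?thesis by (simp add: det_lift_def sum_distrib_left)
qed

text \<open>This is the case of a determinant with two equal rows: \<open>z\<close> repeats a value
  at \<open>a\<close> and \<open>b\<close>. Composition with their transposition matches even with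
  odd permutations and the terms cancel in pairs; concluding from S = -S would fail where 2 is a
  zero divisor.\<close>

lemma row_sum_TS_not_permutes:
  fixes z :: "'n::finite \<Rightarrow> 'n"
  assumes "y \<in> TS" "\<not> z permutes UNIV"
  shows "(\<Sum>p | p permutes UNIV. of_int (sign p) * matrix_entry z p y) = 0"
proof -
  have "\<not> inj z"
    using assms(2) finite_UNIV_inj_surj[of z] bij_imp_permutes[of z UNIV] by (auto simp: bij_def)
  then obtain a b where ab: "a \<noteq> b" "z a = z b" by (auto simp: inj_def)
  define t where "t = Transposition.transpose a b"
  have t: "t permutes UNIV" by (simp add: t_def permutes_swap_id)
  have zt: "z \<circ> t = z" using ab by (auto simp: t_def Transposition.transpose_def)
  have tt: "t \<circ> t = id" by (simp add: t_def)
  have perm: "p permutes UNIV \<Longrightarrow> permutation p" for p :: "'n \<Rightarrow> 'n"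
    by (auto intro: permutes_imp_permutation[of UNIV])
  have sgn: "sign (p \<circ> t) = - sign p" if "p permutes UNIV" for p
    using sign_compose[OF perm[OF that] perm[OF t]] ab by (simp add: t_def sign_swap_id)
  let ?S = "{p :: 'n \<Rightarrow> 'n. p permutes UNIV}"
  let ?E = "{p \<in> ?S. sign p = 1}" and ?O = "{p \<in> ?S. sign p = - 1}"
  let ?f = "\<lambda>p. of_int (sign p) * matrix_entry z p y"
  have "bij_betw (\<lambda>p. p \<circ> t) ?E ?O"
    by (rule bij_betw_byWitness[where f' = "\<lambda>p. p \<circ> t"])
      (auto simp: sgn o_assoc[symmetric] tt intro: permutes_compose[OF t])
  then have "sum ?f ?O = (\<Sum>p\<in>?E. ?f (p \<circ> t))"
    by (rule sum.reindex_bij_betw[symmetric])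
  also have "\<dots> = (\<Sum>p\<in>?E. - ?f p)"
  proof (rule sum.cong[OF refl])
    fix p assume "p \<in> ?E"
    then show "?f (p \<circ> t) = - ?f p"
      using matrix_entry_TS[OF assms(1) t, of z p] by (simp add: sgn zt)
  qed
  finally have "sum ?f ?E + sum ?f ?O = 0" by (simp add: sum_negf)
  moreover have "?S = ?E \<union> ?O" by (auto simp: sign_def)
  then have "sum ?f ?S = sum ?f ?E + sum ?f ?O"
    by (metis (mono_tags, lifting) sum.union_disjoint finite disjoint_iff mem_Collect_eq one_neq_neg_one)
  ultimately show ?thesis by simp
qed

text \<open>A symmetric tensor acts on the tensor power of the free module of rank \<open>n\<close> and commutes with
  the permutations of the factors, hence acts on the top exterior power, where it is a scalar.\<close>

lemma det_lift_mult_TS: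
  fixes x y :: "('k::comm_ring_1, 'm::finite, 'n::finite) tensor_power"
  assumes "y \<in> TS"
  shows "det_lift (x * y) = det_lift x * det_lift y"
proof -
  let ?R = "\<lambda>z. \<Sum>p | p permutes UNIV. of_int (sign p) * matrix_entry z p y"
  have "det_lift (x * y) =
      (\<Sum>p | p permutes UNIV. \<Sum>z\<in>UNIV. matrix_entry id z x * (of_int (sign p) * matrix_entry z p y))"
    by (simp add: det_lift_def matrix_entry_mult sum_distrib_left mult_ac)
  also have "\<dots> = (\<Sum>z\<in>UNIV. matrix_entry id z x * ?R z)"
    unfolding sum_distrib_left by (rule sum.swap)
  \<comment> \<open>Antisymmetrization kills the basis vectors with a repeated index.\<close>
  also have "\<dots> = (\<Sum>z | z permutes UNIV. matrix_entry id z x * ?R z)"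
    by (rule sum.mono_neutral_right) (auto simp: row_sum_TS_not_permutes[OF assms])
  also have "\<dots> = (\<Sum>z | z permutes UNIV. of_int (sign z) * matrix_entry id z x * det_lift y)"
    by (rule sum.cong) (simp_all add: row_sum_TS_permutes[OF assms] mult_ac)
  finally show ?thesis by (simp add: det_lift_def sum_distrib_right)
qed

lemma det_lift_base_change:
  fixes f :: "(('k::comm_ring_1, 'm::finite) mpoly, nat) mpoly"
  shows "Poly_Mapping.map det_lift (tensor_power_of f) =
    det (eval_base_change f :: (('k, 'm, 'n::finite) AP, nat) mpoly ^ 'n ^ 'n)"
proof (rule poly_mapping_eqI)
  fix k
  \<comment> \<open>Signs are 1 or -1, so they pass through the extraction of a coefficient.\<close>
  have sgn: "Poly_Mapping.lookup (of_int (sign p) * q) k = of_int (sign p) * Poly_Mapping.lookup q k"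
    for p :: "'n \<Rightarrow> 'n" and q :: "(('k, 'm, 'n) AP, nat) mpoly"
    by (cases p rule: sign_cases) simp_all
  have "(matrix_entry id p (Poly_Mapping.lookup (tensor_power_of f) k) :: ('k, 'm, 'n) AP) =
      Poly_Mapping.lookup (\<Prod>i\<in>UNIV. Poly_Mapping.map (\<lambda>q. eval_poly q $ i $ p i) f) k" for p
    using arg_cong[OF map_matrix_entry_tensor_power_of, of "\<lambda>q. Poly_Mapping.lookup q k" id p f]
    by (simp add: matrix_entry.zero lookup_map_zero)
  then show "Poly_Mapping.lookup (Poly_Mapping.map det_lift (tensor_power_of f)) k =
      Poly_Mapping.lookup (det (eval_base_change f :: (('k, 'm, 'n) AP, nat) mpoly ^ 'n ^ 'n)) k"
    by (simp add: lookup_map_zero det_lift.zero det_def lookup_sum sgn eval_base_change_def)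
      (simp add: det_lift_def)
qed

section \<open>Injectivity: restriction to diagonal matrices\<close>

definition diagonal_entry :: "'m \<times> 'n \<times> 'n \<Rightarrow> ('k::comm_ring_1, 'm, 'n::finite) tensor_power" where
  "diagonal_entry = (\<lambda>(k, i, j). if i = j then slot_embedding i (Var k) else 0)"

definition diagonal_eval ::
    "('k::comm_ring_1, 'm::finite \<times> 'n::finite \<times> 'n) mpoly \<Rightarrow> ('k, 'm, 'n) tensor_power" where
  "diagonal_eval = scalar_extension tensor_const (\<lambda>a. \<Prod>x\<in>UNIV. diagonal_entry x ^ Poly_Mapping.lookup a x)"

interpretation diagonal_eval: ring_map diagonal_eval
  unfolding diagonal_eval_def
  by (rule tensor_const.ring_map_scalar_extension) (simp_all add: lookup_add power_add prod.distrib)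

lemma diagonal_eval_Const: "diagonal_eval (Const c) = tensor_const c"
  by (simp add: diagonal_eval_def Const_def)

lemma diagonal_eval_Var: "diagonal_eval (Var x) = diagonal_entry x"
proof -
  have "(\<Prod>y\<in>UNIV. diagonal_entry y ^ Poly_Mapping.lookup (Poly_Mapping.single x 1) y) =
      (\<Prod>y\<in>UNIV. if y = x then diagonal_entry x else 1)"
    by (rule prod.cong) (auto simp: lookup_single)
  then show ?thesis by (simp add: diagonal_eval_def Var_def tensor_const.one)
qed

text \<open>Diagonal matrices over a commutative ring commute. This already holds for each middle
  index \<open>l\<close> separately, since a product of entries can be nonzero only for
  \<open>i = l\<close> and \<open>l = j\<close>.\<close>

lemma diagonal_eval_ideal:
  fixes x :: "('k::comm_ring_1, 'm::finite \<times> 'n::finite \<times> 'n) mpoly"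
  assumes "x \<in> ideal_generated commutator_entries"
  shows "diagonal_eval x = 0"
  using assms
proof (rule ideal_generated_subset_kernel)
  fix g :: "('k, 'm \<times> 'n \<times> 'n) mpoly"
  assume "g \<in> commutator_entries"
  then obtain k h i j where g: "g = (generic_matrix k ** generic_matrix h - generic_matrix h ** generic_matrix k) $ i $ j"
    by (auto simp: commutator_entries_def)
  have "(diagonal_entry (k, i, l) :: ('k, 'm, 'n) tensor_power) * diagonal_entry (h, l, j) = diagonal_entry (h, i, l) * diagonal_entry (k, l, j)" for l
    by (simp add: diagonal_entry_def mult.commute)
  then show "diagonal_eval g = 0"
    by (simp add: g generic_matrix_def matrix_matrix_mult_def diagonal_eval.diff diagonal_eval.sum
        diagonal_eval.mult diagonal_eval_Var)
qed (simp_all add: diagonal_eval.add diagonal_eval.mult)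

lift_definition diagonal :: "('k::comm_ring_1, 'm::finite, 'n::finite) AP \<Rightarrow> ('k, 'm, 'n) tensor_power"
  is diagonal_eval
  using diagonal_eval_ideal by (force simp: diagonal_eval.diff)

lemma diagonal_AP_class: "diagonal (AP_class p) = diagonal_eval p"
  by transfer (rule refl)

lemma ring_map_diagonal: "ring_map diagonal"
proof
  show "diagonal (x + y) = diagonal x + diagonal y" for x y :: "('a, 'b, 'c) AP"
    by transfer (rule diagonal_eval.add)
  show "diagonal (x * y) = diagonal x * diagonal y" for x y :: "('a, 'b, 'c) AP"
    by transfer (rule diagonal_eval.mult)
  show "diagonal (1 :: ('a, 'b, 'c) AP) = 1"
    by transfer (rule diagonal_eval.one)
qed

interpretation diagonal: ring_map diagonal by (rule ring_map_diagonal)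

lemma diagonal_AP_const: "diagonal (AP_const c) = tensor_const c"
  by (simp add: AP_const_def diagonal_AP_class diagonal_eval_Const)

text \<open>A polynomial is evaluated at diagonal matrices entry by entry: in the product case only
  the middle index \<open>i\<close> survives.\<close>

lemma diagonal_eval_poly:
  "diagonal (eval_poly f $ i $ j) = (if i = j then slot_embedding i f else 0)"
proof (induction f arbitrary: i j rule: mpoly_induct)
  case (const c)
  show ?case
    by (simp add: eval_poly_Const mat_def slot_embedding_Const diagonal_AP_const diagonal.zero)
next
  case (var k)
  show ?case
    by (simp add: eval_poly_Var commuting_matrix_def generic_matrix_def diagonal_AP_class
        diagonal_eval_Var diagonal_entry_def)
next
  case (add f g)
  then show ?case
    by (simp add: eval_poly_add diagonal.add ring_map.axioms(1)[OF ring_map_slot_embedding, THEN Modules.additive.add])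
next
  case (mult f g)
  have "diagonal (eval_poly (f * g) $ i $ j) =
      (\<Sum>l\<in>UNIV. (if i = l then slot_embedding i f else 0) * (if l = j then slot_embedding l g else 0))"
    by (simp add: eval_poly_mult matrix_matrix_mult_def diagonal.sum diagonal.mult mult)
  also have "\<dots> = (\<Sum>l\<in>UNIV. if l = i then (if i = j then slot_embedding i f * slot_embedding i g else 0) else 0)"
    by (rule sum.cong) auto
  finally show ?case
    by (simp add: ring_map.mult[OF ring_map_slot_embedding])
qed

text \<open>For diagonal matrices only the identity permutation contributes, and the product of the
  diagonal entries is the original pure tensor.\<close>

lemma diagonal_det_lift: "diagonal (det_lift x) = x"
proof (induction x rule: tensor_induct)
  case (pure c v)
  have zero: "(\<Prod>i\<in>UNIV. if i = p i then slot_embedding i (v i) else 0) = 0" if "p \<noteq> id" for p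
  proof -
    obtain i where "i \<noteq> p i" using \<open>p \<noteq> id\<close> by (metis eq_id_iff)
    then show ?thesis by (intro prod_zero) auto
  qed
  have "diagonal (det_lift (pure_tensor v)) = (\<Sum>p | p permutes UNIV. of_int (sign p) *
      (\<Prod>i\<in>UNIV. if i = p i then slot_embedding i (v i) else 0))"
    by (simp add: det_lift_def diagonal.sum diagonal.mult diagonal.of_int diagonal.prod
        matrix_entry_pure_tensor diagonal_eval_poly)
  also have "\<dots> = (\<Sum>p\<in>{id}. of_int (sign p) * (\<Prod>i\<in>UNIV. if i = p i then slot_embedding i (v i) else 0))"
    by (rule sum.mono_neutral_right) (auto simp: zero permutes_id)
  also have "\<dots> = pure_tensor v" by (simp add: pure_tensor_eq_prod)
  finally show ?case
    by (simp add: det_lift_scale diagonal.mult diagonal_AP_const)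
qed (simp add: det_lift.add diagonal.add)

section \<open>Coefficients of characteristic polynomials\<close>

definition elementary_symmetric :: "nat \<Rightarrow> ('k::comm_ring_1, 'm) mpoly \<Rightarrow> ('k, 'm, 'n::finite) tensor_power" where
  "elementary_symmetric k f = (\<Sum>J | card J = k. pure_tensor (\<lambda>i. if i \<in> J then f else 1))"

lemma card_Compl_eq_iff:
  fixes J :: "'n::finite set"
  assumes "k \<le> CARD('n)"
  shows "card (UNIV - J) = CARD('n) - k \<longleftrightarrow> card J = k"
proof -
  have "card J \<le> CARD('n)" by (rule card_mono) auto
  then show ?thesis using assms by (auto simp: card_Diff_subset)
qed

text \<open>The right-hand side is the sum of the principal \<open>k\<close> by \<open>k\<close>
  minors of \<open>M\<close>, each written as a determinant whose rows outside \<open>J\<close> come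
  from the identity. It arises by splitting every factor of a Leibniz term into its constant and its
  linear part.\<close>

lemma coeff_charpoly:
  fixes M :: "'a::comm_ring_1 ^ 'n ^ 'n::finite"
  assumes "k \<le> CARD('n)"
  shows "(- 1) ^ k * coeff (charpoly M) (CARD('n) - k) =
    (\<Sum>p | p permutes UNIV. of_int (sign p) *
      (\<Sum>J | card J = k. \<Prod>i\<in>UNIV. (if i \<in> J then M else mat 1) $ i $ p i))"
proof -
  have const: "(\<Prod>i\<in>J. [:c i:]) = [:\<Prod>i\<in>J. c i:]" for c :: "'n \<Rightarrow> 'a" and J
    by (induction J rule: infinite_finite_induct) (simp_all add: one_pCons)
  have monom: "(\<Prod>i\<in>J. monom (c i) 1) = monom (\<Prod>i\<in>J. c i) (card J)" for c :: "'n \<Rightarrow> 'a" and J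
    by (induction J rule: infinite_finite_induct) (simp_all add: mult_monom)
  have "(- 1) ^ k * coeff (\<Prod>i\<in>UNIV. mat [:0, 1:] $ i $ p i - [:M $ i $ p i:]) (CARD('n) - k) =
      (\<Sum>J | card J = k. \<Prod>i\<in>UNIV. (if i \<in> J then M else mat 1) $ i $ p i)" for p
  proof -
    have "(\<Prod>i\<in>UNIV. mat [:0, 1:] $ i $ p i - [:M $ i $ p i:]) =
        (\<Prod>i\<in>UNIV. [:- (M $ i $ p i):] + monom (mat 1 $ i $ p i) 1)"
      by (rule prod.cong) (auto simp: mat_def monom_altdef)
    \<comment> \<open>\<open>J\<close> is the set of rows contributing a constant; every other row
      contributes one power of the variable, so the degree is the size of the complement.\<close>
    also have "\<dots> = (\<Sum>J\<in>UNIV. monom ((\<Prod>i\<in>J. - (M $ i $ p i)) * (\<Prod>i\<in>UNIV - J. mat 1 $ i $ p i)) (card (UNIV - J)))"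
      by (simp add: prod_add const monom[simplified] smult_monom)
    finally have "coeff (\<Prod>i\<in>UNIV. mat [:0, 1:] $ i $ p i - [:M $ i $ p i:]) (CARD('n) - k) =
        (\<Sum>J\<in>UNIV. if card J = k then (\<Prod>i\<in>J. - (M $ i $ p i)) * (\<Prod>i\<in>UNIV - J. mat 1 $ i $ p i) else 0)"
      by (simp add: coeff_sum card_Compl_eq_iff[OF assms])
    also have "\<dots> = (\<Sum>J | card J = k. (\<Prod>i\<in>J. - (M $ i $ p i)) * (\<Prod>i\<in>UNIV - J. mat 1 $ i $ p i))"
      by (simp add: sum.If_cases)
    also have "\<dots> = (\<Sum>J | card J = k. (- 1) ^ k * (\<Prod>i\<in>UNIV. (if i \<in> J then M else mat 1) $ i $ p i))"
    proof (rule sum.cong[OF refl])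
      fix J :: "'n set"
      assume "J \<in> {J. card J = k}"
      then have "(\<Prod>i\<in>J. - (M $ i $ p i)) = (- 1) ^ k * (\<Prod>i\<in>J. M $ i $ p i)"
        by (simp add: prod_uminus)
      moreover have "(\<Prod>i\<in>UNIV. (if i \<in> J then M else mat 1) $ i $ p i) =
          (\<Prod>i\<in>J. (if i \<in> J then M else mat 1) $ i $ p i) * (\<Prod>i\<in>UNIV - J. (if i \<in> J then M else mat 1) $ i $ p i)"
        by (subst prod.subset_diff[of J UNIV]) (auto simp: mult.commute)
      ultimately show "(\<Prod>i\<in>J. - (M $ i $ p i)) * (\<Prod>i\<in>UNIV - J. mat 1 $ i $ p i) =
          (- 1) ^ k * (\<Prod>i\<in>UNIV. (if i \<in> J then M else mat 1) $ i $ p i)"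
        by (simp add: mult.assoc)
    qed
    finally show ?thesis
      by (simp add: sum_distrib_left mult.assoc[symmetric] flip: power_mult_distrib)
  qed
  then show ?thesis
    by (simp add: charpoly_def det_def coeff_sum of_int_poly sum_distrib_left mult.left_commute[of "(- 1) ^ k"])
qed

text \<open>A factor 1 in slot \<open>i\<close> yields row \<open>i\<close> of the identity matrix,
  so each summand becomes one of the determinants in \<open>coeff_charpoly\<close>.\<close>

lemma det_lift_elementary_symmetric:
  fixes f :: "('k::comm_ring_1, 'm::finite) mpoly"
  assumes "k \<le> CARD('n::finite)"
  shows "det_lift (elementary_symmetric k f) = (charpoly_coeff k f :: ('k, 'm, 'n) AP)"
  unfolding charpoly_coeff_def coeff_charpoly[OF assms]
  by (auto simp: elementary_symmetric_def det_lift_def matrix_entry.sum matrix_entry_pure_tensor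
      if_distrib[of eval_poly] eval_poly_one sum_distrib_left intro!: sum.cong prod.cong cong: if_cong)

text \<open>Expand the tensor power of \<open>f\<close> plus a new variable: \<open>J\<close> is the
  set of slots where \<open>f\<close> is chosen, so its complement gives the exponent of the
  variable. Through this formula the base-changed law fixes the values of a homomorphism on these
  tensors.\<close>

lemma elementary_symmetric_eq_lookup:
  fixes f :: "('k::comm_ring_1, 'm) mpoly"
  assumes "k \<le> CARD('n::finite)"
  shows "(elementary_symmetric k f :: ('k, 'm, 'n) tensor_power) =
    Poly_Mapping.lookup (tensor_power_of (Poly_Mapping.single 0 f + Poly_Mapping.single (Poly_Mapping.single 0 1) 1))
      (Poly_Mapping.single 0 (CARD('n) - k))"
proof -
  interpret S: ring_map "slot_embedding i :: _ \<Rightarrow> ('k, 'm, 'n) tensor_power" for i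
    by (rule ring_map_slot_embedding)
  have map: "Poly_Mapping.map (slot_embedding i) (Poly_Mapping.single 0 f + Poly_Mapping.single (Poly_Mapping.single 0 1) 1) =
      Poly_Mapping.single 0 (slot_embedding i f :: ('k, 'm, 'n) tensor_power) +
      Poly_Mapping.single (Poly_Mapping.single (0 :: nat) (1 :: nat)) 1" for i
    by (simp add: Modules.additive.add[OF additive_poly_mapping_map[OF S.additive_axioms]] S.zero S.one)
  have mult: "(\<Sum>i\<in>J. Poly_Mapping.single (0 :: nat) (1 :: nat)) = Poly_Mapping.single 0 (card J)" for J :: "'n set"
    by (induction J rule: infinite_finite_induct) (simp_all del: sum_constant flip: single_add)
  note mult = mult[unfolded One_nat_def]
  have inj: "Poly_Mapping.single (0 :: nat) a = Poly_Mapping.single 0 b \<longleftrightarrow> a = b" for a b :: nat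
    by (metis lookup_single_eq)
  have "tensor_power_of (Poly_Mapping.single 0 f + Poly_Mapping.single (Poly_Mapping.single 0 1) 1) =
      (\<Sum>J\<in>UNIV. Poly_Mapping.single (Poly_Mapping.single 0 (card (UNIV - J)))
        (pure_tensor (\<lambda>i :: 'n. if i \<in> J then f else 1)))"
    unfolding tensor_power_of_def map
    by (simp add: prod_add prod_single mult mult_single prod_slot_embedding del: prod_constant sum_constant)
  then show ?thesis
    by (simp add: lookup_sum lookup_single inj card_Compl_eq_iff[OF assms] when_def elementary_symmetric_def sum.If_cases)
qed

lemma elementary_symmetric_in_TS:
  "k \<le> CARD('n) \<Longrightarrow> elementary_symmetric k f \<in> (TS :: ('k::comm_ring_1, 'm, 'n::finite) tensor_power set)"
  by (simp only: elementary_symmetric_eq_lookup tensor_power_of_in_TS)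


section \<open>Generators of the ring of symmetric tensors\<close>

definition monomial_tensor :: "('n \<Rightarrow> 'm \<Rightarrow>\<^sub>0 nat) \<Rightarrow> ('k::comm_ring_1, 'm, 'n::finite) tensor_power" where
  "monomial_tensor a = pure_tensor (\<lambda>i. Poly_Mapping.single (a i) 1)"

definition monomial_combination ::
    "(('n \<Rightarrow> 'm \<Rightarrow>\<^sub>0 nat) \<Rightarrow>\<^sub>0 'k) \<Rightarrow> ('k::comm_ring_1, 'm, 'n::finite) tensor_power" where
  "monomial_combination = scalar_extension tensor_const monomial_tensor"

interpretation monomial_combination: additive monomial_combination
  unfolding monomial_combination_def by (rule tensor_const.additive_scalar_extension)

lemma monomial_combination_single:
  "monomial_combination (Poly_Mapping.single a c) = tensor_const c * monomial_tensor a"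
  by (simp add: monomial_combination_def)

lemma monomial_combination_surj: "\<exists>p. x = monomial_combination p"
proof (induction x rule: tensor_induct)
  case (pure c v)
  define K where "K = (\<Union>i. Poly_Mapping.keys (v i))"
  have K: "finite K" by (simp add: K_def)
  have slot: "slot_embedding i (v i) = (\<Sum>\<mu>\<in>K. tensor_const (Poly_Mapping.lookup (v i) \<mu>) *
      slot_embedding i (Poly_Mapping.single \<mu> 1))" for i
  proof -
    interpret S: ring_map "slot_embedding i" by (rule ring_map_slot_embedding)
    have "Poly_Mapping.keys (v i) \<subseteq> K" by (auto simp: K_def)
    from sum_single_lookup[OF K this]
    have "slot_embedding i (v i) =
        slot_embedding i (\<Sum>\<mu>\<in>K. Const (Poly_Mapping.lookup (v i) \<mu>) * Poly_Mapping.single \<mu> 1)"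
      by (simp add: Const_def mult_single)
    then show ?thesis by (simp add: S.sum S.mult slot_embedding_Const)
  qed
  have "tensor_const c * pure_tensor v = tensor_const c *
      (\<Sum>\<kappa>\<in>UNIV \<rightarrow>\<^sub>E K. \<Prod>i\<in>UNIV. tensor_const (Poly_Mapping.lookup (v i) (\<kappa> i)) *
        slot_embedding i (Poly_Mapping.single (\<kappa> i) 1))"
    unfolding pure_tensor_eq_prod[of v] slot by (simp add: prod_sum_PiE K)
  also have "\<dots> = (\<Sum>\<kappa>\<in>UNIV \<rightarrow>\<^sub>E K.
      tensor_const (c * (\<Prod>i\<in>UNIV. Poly_Mapping.lookup (v i) (\<kappa> i))) * monomial_tensor \<kappa>)"
    by (simp add: prod.distrib monomial_tensor_def pure_tensor_eq_prod tensor_const.mult tensor_const.prod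
        sum_distrib_left mult.assoc)
  finally show ?case
    by (simp flip: monomial_combination_single monomial_combination.sum) blast
next
  case (add x y)
  then obtain p q where "x = monomial_combination p" "y = monomial_combination q" by blast
  then show ?case by (metis monomial_combination.add)
qed

text \<open>The coordinate functional of \<open>monomial_tensor a\<close>. Together with
  \<open>monomial_combination_surj\<close> it shows that the monomial tensors form a basis.\<close>

definition tensor_coeff :: "('n \<Rightarrow> 'm \<Rightarrow>\<^sub>0 nat) \<Rightarrow> ('k::comm_ring_1, 'm, 'n::finite) tensor_power \<Rightarrow> 'k" where
  "tensor_coeff a = tensor_lift (\<lambda>c. c) (\<lambda>i f. Poly_Mapping.lookup f (a i))"

interpretation coeff_functional: tensor_functional "\<lambda>c. c" "\<lambda>i f. Poly_Mapping.lookup f (a i)" for a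
proof unfold_locales
  show "Poly_Mapping.lookup (Const c * f) (a i) = c * Poly_Mapping.lookup f (a i)" for c f i
    by (simp add: Const_def lookup_map_zero flip: mult_map_scale_conv_mult)
qed (simp_all add: lookup_add)

interpretation tensor_coeff: additive "tensor_coeff a" for a
  unfolding tensor_coeff_def by (rule coeff_functional.lift.additive_axioms)

lemma tensor_coeff_pure: "tensor_coeff a (tensor_const c * pure_tensor v) = c * (\<Prod>i\<in>UNIV. Poly_Mapping.lookup (v i) (a i))"
  unfolding tensor_coeff_def by (rule coeff_functional.tensor_lift_pure)

lemma tensor_coeff_monomial_combination:
  fixes p :: "('n::finite \<Rightarrow> 'm \<Rightarrow>\<^sub>0 nat) \<Rightarrow>\<^sub>0 'k::comm_ring_1"
  shows "tensor_coeff a (monomial_combination p) = Poly_Mapping.lookup p a"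
proof (induction p rule: poly_mapping_additive_induct)
  case (single b c)
  have "(\<Prod>i\<in>UNIV. Poly_Mapping.lookup (Poly_Mapping.single (b i) 1) (a i)) = (if b = a then 1 else 0 :: 'k)"
  proof (cases "b = a")
    case False
    then obtain i where "b i \<noteq> a i" by blast
    then have "(\<Prod>i\<in>UNIV. Poly_Mapping.lookup (Poly_Mapping.single (b i) (1 :: 'k)) (a i)) = 0"
      by (intro prod_zero) (auto simp: lookup_single intro!: exI[of _ i])
    with False show ?thesis by simp
  qed simp
  then show ?case
    by (simp add: monomial_combination_single monomial_tensor_def tensor_coeff_pure lookup_single when_def)
qed (simp_all add: monomial_combination.zero monomial_combination.add tensor_coeff.zero tensor_coeff.add lookup_add)

lemma tensor_coeff_permute:
  "tensor_coeff a (permute_tensor \<sigma> x) = tensor_coeff (a \<circ> Perm.apply \<sigma>) x"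
proof (induction x rule: tensor_induct)
  case (pure c v)
  have "(\<Prod>i\<in>UNIV. Poly_Mapping.lookup ((v \<circ> Perm.apply (inverse \<sigma>)) i) (a i)) =
      (\<Prod>i\<in>UNIV. Poly_Mapping.lookup ((v \<circ> Perm.apply (inverse \<sigma>)) (Perm.apply \<sigma> i)) (a (Perm.apply \<sigma> i)))"
    by (rule prod.reindex_bij_betw[symmetric]) (rule bij_apply)
  also have "\<dots> = (\<Prod>i\<in>UNIV. Poly_Mapping.lookup (v i) ((a \<circ> Perm.apply \<sigma>) i))"
    by (simp add: Perm.apply_inverse bij_is_inj)
  finally show ?case
    by (simp only: permute_tensor.mult permute_tensor_const permute_pure_tensor tensor_coeff_pure)
qed (simp add: permute_tensor.add tensor_coeff.add)

section \<open>Orbits of exponent families under permutations of the slots\<close>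

definition rearrangements :: "('n \<Rightarrow> 'a) \<Rightarrow> ('n \<Rightarrow> 'a) set" where
  "rearrangements a = {a \<circ> p | p. p permutes UNIV}"

lemma finite_rearrangements [simp]: "finite (rearrangements (a :: 'n::finite \<Rightarrow> 'a))"
  by (simp add: rearrangements_def finite_permutations)

lemma rearrangements_self: "a \<in> rearrangements a"
  by (auto simp: rearrangements_def intro: exI[of _ id] permutes_id)

lemma card_rearrangement:
  assumes "b \<in> rearrangements a"
  shows "card {i. P (b i)} = card {i. P (a i)}"
proof -
  obtain p where p: "p permutes UNIV" and b: "b = a \<circ> p"
    using assms by (auto simp: rearrangements_def)
  have "bij_betw p {i. P (b i)} {i. P (a i)}"
    using permutes_bij[OF p] b by (auto simp: bij_betw_def inj_on_def image_iff)
  then show ?thesis by (rule bij_betw_same_card)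
qed

text \<open>Two families are rearrangements of each other when their multisets of values agree. The
  multiplicity of 0 is determined by the others, as the total is the number of slots.\<close>

lemma rearrangementI:
  fixes a b :: "'n::finite \<Rightarrow> 'a::zero"
  assumes "\<And>x. x \<noteq> 0 \<Longrightarrow> card {i. b i = x} = card {i. a i = x}"
  shows "b \<in> rearrangements a"
proof -
  let ?M = "\<lambda>f :: 'n \<Rightarrow> 'a. image_mset f (mset_set UNIV)"
  have count: "count (?M f) x = card {i. f i = x}" for f x
    by (simp add: count_image_mset vimage_def)
  have size: "count (?M f) 0 + size (filter_mset (\<lambda>x. x \<noteq> 0) (?M f)) = CARD('n)" for f
  proof -
    have "size (?M f) = size (filter_mset (\<lambda>x. x = 0) (?M f)) + size (filter_mset (\<lambda>x. x \<noteq> 0) (?M f))"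
      by (metis multiset_partition size_union)
    then show ?thesis by (simp add: filter_eq_replicate_mset)
  qed
  have filter: "filter_mset (\<lambda>x. x \<noteq> 0) (?M b) = filter_mset (\<lambda>x. x \<noteq> 0) (?M a)"
    by (rule multiset_eqI) (simp add: count assms)
  have "?M b = ?M a"
  proof (rule multiset_eqI)
    fix x
    show "count (?M b) x = count (?M a) x"
      using size[of a] size[of b] by (cases "x = 0") (simp_all add: filter count[of _ x] assms)
  qed
  then obtain p where "p permutes UNIV" "\<forall>i\<in>UNIV. b i = a (p i)"
    by (rule image_mset_eq_implies_permutes[OF finite])
  then have "b = a \<circ> p" by auto
  with \<open>p permutes UNIV\<close> show ?thesis by (auto simp: rearrangements_def)
qed

text \<open>The sum runs over distinct rearrangements and not over permutations, since the orders of
  stabilizers need not be invertible in \<open>'k\<close>.\<close>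

definition orbit_sum :: "('n \<Rightarrow> 'm \<Rightarrow>\<^sub>0 nat) \<Rightarrow> ('k::comm_ring_1, 'm, 'n::finite) tensor_power" where
  "orbit_sum a = (\<Sum>b\<in>rearrangements a. monomial_tensor b)"

lemma apply_permutes: "Perm.apply \<sigma> permutes UNIV"
  by (rule bij_imp_permutes) simp_all

lemma orbit_sum_in_TS: "orbit_sum a \<in> (TS :: ('k::comm_ring_1, 'm, 'n::finite) tensor_power set)"
proof -
  have "permute_tensor \<sigma> (orbit_sum a) = (orbit_sum a :: ('k, 'm, 'n) tensor_power)" for \<sigma>
  proof -
    have comp: "b \<circ> Perm.apply \<tau> \<in> rearrangements a" if "b \<in> rearrangements a" for b \<tau>
    proof -
      obtain p where "p permutes UNIV" "b = a \<circ> p"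
        using \<open>b \<in> rearrangements a\<close> by (auto simp: rearrangements_def)
      then show ?thesis
        using permutes_compose[OF apply_permutes, of p \<tau>] by (auto simp: rearrangements_def o_assoc[symmetric])
    qed
    have cancel: "Perm.apply (inverse \<sigma>) \<circ> Perm.apply \<sigma> = id" "Perm.apply \<sigma> \<circ> Perm.apply (inverse \<sigma>) = id"
      by (simp_all add: fun_eq_iff Perm.apply_inverse bij_is_inj bij_is_surj surj_f_inv_f)
    have "bij_betw (\<lambda>b. b \<circ> Perm.apply (inverse \<sigma>)) (rearrangements a) (rearrangements a)"
      by (intro bij_betw_byWitness[where f' = "\<lambda>b. b \<circ> Perm.apply \<sigma>"])
        (auto simp: o_assoc[symmetric] cancel intro: comp)
    then have "(\<Sum>b\<in>rearrangements a. monomial_tensor (b \<circ> Perm.apply (inverse \<sigma>))) =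
        (orbit_sum a :: ('k, 'm, 'n) tensor_power)"
      unfolding orbit_sum_def by (rule sum.reindex_bij_betw)
    moreover have "permute_tensor \<sigma> (monomial_tensor b) =
        (monomial_tensor (b \<circ> Perm.apply (inverse \<sigma>)) :: ('k, 'm, 'n) tensor_power)" for b
      by (simp add: monomial_tensor_def permute_pure_tensor o_def)
    ultimately show ?thesis by (simp add: orbit_sum_def permute_tensor.sum)
  qed
  then show ?thesis by (simp add: TS_def)
qed

text \<open>Permuting a tensor permutes its coordinates, so the coordinates of a symmetric tensor
  are constant on orbits.\<close>

lemma lookup_rearrangement:
  assumes "monomial_combination p \<in> TS" "b \<in> rearrangements a"
  shows "Poly_Mapping.lookup p b = Poly_Mapping.lookup p a"
proof -
  obtain q where "q permutes UNIV" and b: "b = a \<circ> q"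
    using assms(2) by (auto simp: rearrangements_def)
  then obtain \<sigma> where "Perm.apply \<sigma> = q" using apply_surj by metis
  then show ?thesis
    using assms(1) tensor_coeff_permute[of a \<sigma> "monomial_combination p"] b
    by (simp add: TS_def tensor_coeff_monomial_combination)
qed

text \<open>Subtracting a multiple of one orbit sum erases a whole orbit from the support, so the
  support shrinks. Only orbits of keys of \<open>p\<close> occur, which lets a bound on the keys
  carry over to the induction in \<open>TS_subset_subalgebra\<close>.\<close>

lemma TS_orbit_induct [consumes 1, case_names zero add orbit]:
  assumes "monomial_combination p \<in> TS"
    and zero: "Q 0" and add: "\<And>x y. Q x \<Longrightarrow> Q y \<Longrightarrow> Q (x + y)"
    and orbit: "\<And>c a. a \<in> Poly_Mapping.keys p \<Longrightarrow> Q (tensor_const c * orbit_sum a)"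
  shows "Q (monomial_combination p)"
  using assms(1) orbit
proof (induction "card (Poly_Mapping.keys p)" arbitrary: p rule: less_induct)
  case less
  show ?case
  proof (cases "p = 0")
    case True
    then show ?thesis by (simp add: monomial_combination.zero zero)
  next
    case False
    then obtain a where a: "a \<in> Poly_Mapping.keys p" by fastforce
    define c where "c = Poly_Mapping.lookup p a"
    define q where "q = p - (\<Sum>b\<in>rearrangements a. Poly_Mapping.single b c)"
    have q: "monomial_combination q = monomial_combination p - tensor_const c * orbit_sum a"
      by (simp add: q_def monomial_combination.diff monomial_combination.sum monomial_combination_single
          orbit_sum_def sum_distrib_left)
    have lookup: "Poly_Mapping.lookup q b = (if b \<in> rearrangements a then 0 else Poly_Mapping.lookup p b)" for b
      using lookup_rearrangement[OF less.prems(1), of b a]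
      by (simp add: q_def lookup_minus lookup_sum lookup_single when_def c_def)
    have keys: "Poly_Mapping.keys q = Poly_Mapping.keys p - rearrangements a"
      by (auto simp: in_keys_iff lookup split: if_splits)
    have "card (Poly_Mapping.keys q) < card (Poly_Mapping.keys p)"
      unfolding keys by (rule psubset_card_mono) (use a rearrangements_self in auto)
    moreover have "monomial_combination q \<in> TS"
      unfolding q by (intro TS_diff TS_mult TS_const orbit_sum_in_TS less.prems(1))
    moreover have "Q (tensor_const d * orbit_sum b)" if "b \<in> Poly_Mapping.keys q" for d b
      using that keys less.prems(2) by blast
    ultimately have "Q (monomial_combination q)" by (rule less.hyps)
    from add[OF this less.prems(2)[OF a, of c]] show ?thesis by (simp add: q)
  qed
qed

text \<open>Families with values 0 and \<open>\<mu>\<close> correspond to sets of slots, and two of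
  them are rearrangements of each other exactly when the sets have the same size.\<close>

lemma orbit_sum_constant:
  fixes J :: "'n::finite set" and \<mu> :: "'m \<Rightarrow>\<^sub>0 nat"
  assumes "\<mu> \<noteq> 0"
  shows "orbit_sum (\<lambda>i. if i \<in> J then \<mu> else 0) = elementary_symmetric (card J) (Poly_Mapping.single \<mu> 1)"
proof -
  let ?u = "\<lambda>J :: 'n set. \<lambda>i. if i \<in> J then \<mu> else 0"
  have inj: "inj ?u"
    by (rule injI) (metis (mono_tags) assms set_eqI)
  have "rearrangements (?u J) = ?u ` {I. card I = card J}"
  proof (intro equalityI subsetI)
    fix b assume b: "b \<in> rearrangements (?u J)"
    let ?I = "{i. b i = \<mu>}"
    have "b = ?u ?I" using b by (auto simp: rearrangements_def)
    moreover have "card ?I = card J"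
      using card_rearrangement[OF b, of "\<lambda>x. x = \<mu>"] assms by simp
    ultimately show "b \<in> ?u ` {I. card I = card J}" by blast
  next
    fix b assume "b \<in> ?u ` {I. card I = card J}"
    then obtain I where I: "b = ?u I" "card I = card J" by blast
    show "b \<in> rearrangements (?u J)"
    proof (rule rearrangementI)
      fix x :: "'m \<Rightarrow>\<^sub>0 nat" assume "x \<noteq> 0"
      then have "{i. ?u S i = x} = (if x = \<mu> then S else {})" for S by auto
      then show "card {i. b i = x} = card {i. ?u J i = x}" by (simp add: I)
    qed
  qed
  then have "orbit_sum (?u J) = (\<Sum>I | card I = card J. monomial_tensor (?u I))"
    by (simp add: orbit_sum_def sum.reindex inj_on_subset[OF inj])
  then show ?thesis
    by (simp add: elementary_symmetric_def monomial_tensor_def if_distrib[of "\<lambda>\<mu>. Poly_Mapping.single \<mu> 1"] cong: if_cong)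
qed

lemma monomial_tensor_mult: "monomial_tensor a * monomial_tensor b = monomial_tensor (\<lambda>i. a i + b i)"
  by (simp add: monomial_tensor_def pure_tensor_mult mult_single)

text \<open>Splitting \<open>v\<close> into the slots with a fixed nonzero value \<open>\<mu>\<close> and the others, the product of the two
  orbit sums is the orbit sum of \<open>v\<close> plus terms in which slots have collided.\<close>

lemma orbit_sum_split:
  fixes v :: "'n::finite \<Rightarrow> 'm \<Rightarrow>\<^sub>0 nat" and \<mu> :: "'m \<Rightarrow>\<^sub>0 nat"
  assumes "\<mu> \<noteq> 0"
  defines "u \<equiv> \<lambda>i. if v i = \<mu> then \<mu> else 0" and "w \<equiv> \<lambda>i. if v i = \<mu> then 0 else v i"
  obtains p where
    "(orbit_sum u * orbit_sum w :: ('k::comm_ring_1, 'm, 'n) tensor_power) = orbit_sum v + monomial_combination p"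
    "\<And>a. a \<in> Poly_Mapping.keys p \<Longrightarrow> card {i. a i \<noteq> 0} < card {i. v i \<noteq> 0}"
proof -
  define S where "S = rearrangements u \<times> rearrangements w"
  \<comment> \<open>The pairs without collision: in each slot at most one of the two exponents is
    nonzero.\<close>
  define D where "D = {(a, b) \<in> S. \<forall>i. a i = 0 \<or> b i = 0}"
  have S: "finite S" by (simp add: S_def)
  have D: "D \<subseteq> S" by (auto simp: D_def)
  let ?plus = "\<lambda>(a, b). \<lambda>i :: 'n. a i + b i :: 'm \<Rightarrow>\<^sub>0 nat"
  have disjoint: "card {i. a i + b i = x} = card {i. a i = x} + card {i. b i = x}"
    if "\<forall>i. a i = 0 \<or> b i = 0" "x \<noteq> 0" for a b :: "'n \<Rightarrow> 'm \<Rightarrow>\<^sub>0 nat" and x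
  proof -
    have "{i. a i + b i = x} = {i. a i = x} \<union> {i. b i = x}"
    proof (rule set_eqI)
      fix i
      show "i \<in> {i. a i + b i = x} \<longleftrightarrow> i \<in> {i. a i = x} \<union> {i. b i = x}"
        using that(1)[rule_format, of i] that(2) by auto
    qed
    moreover have "{i. a i = x} \<inter> {i. b i = x} = {}" using that by auto
    ultimately show ?thesis by (simp add: card_Un_disjoint)
  qed
  have uw: "\<forall>i. u i = 0 \<or> w i = 0" "v i = u i + w i" for i by (simp_all add: u_def w_def)
  have plus: "?plus (a, b) \<in> rearrangements v" if "(a, b) \<in> D" for a b
  proof (rule rearrangementI)
    fix x :: "'m \<Rightarrow>\<^sub>0 nat" assume x: "x \<noteq> 0"
    have "a \<in> rearrangements u" "b \<in> rearrangements w" "\<forall>i. a i = 0 \<or> b i = 0"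
      using that by (auto simp: D_def S_def)
    then show "card {i. ?plus (a, b) i = x} = card {i. v i = x}"
      using disjoint[OF _ x] card_rearrangement[of a u "\<lambda>y. y = x"] card_rearrangement[of b w "\<lambda>y. y = x"]
      by (simp add: uw)
  qed
  \<comment> \<open>The inverse of addition on \<open>D\<close>: the value \<open>\<mu>\<close>
    marks the slots that come from \<open>u\<close>, since rearrangements of \<open>w\<close> never
    take it.\<close>
  let ?split = "\<lambda>s. (\<lambda>i. if s i = \<mu> then \<mu> else 0, \<lambda>i. if s i = \<mu> then 0 else s i)"
  have split_plus: "?split (?plus (a, b)) = (a, b)" if "(a, b) \<in> D" for a b
  proof -
    have "a i = \<mu> \<and> b i = 0 \<or> a i = 0 \<and> b i \<noteq> \<mu>" for i
      using that \<open>\<mu> \<noteq> 0\<close> by (auto simp: D_def S_def rearrangements_def u_def w_def split: if_splits)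
    then have "(if a i + b i = \<mu> then \<mu> else 0) = a i \<and> (if a i + b i = \<mu> then 0 else a i + b i) = b i" for i
      using \<open>\<mu> \<noteq> 0\<close> by (metis add_0 add.right_neutral)
    then show ?thesis by (simp only: case_prod_conv prod.inject fun_eq_iff simp_thms)
  qed
  have "bij_betw ?plus D (rearrangements v)"
  proof (rule bij_betw_byWitness[where f' = ?split])
    show "\<forall>z\<in>D. ?split (?plus z) = z"
    proof
      fix z assume "z \<in> D"
      then show "?split (?plus z) = z" by (cases z) (simp only: split_plus)
    qed
    show "?plus ` D \<subseteq> rearrangements v"
    proof
      fix s assume "s \<in> ?plus ` D"
      then obtain a b where "(a, b) \<in> D" "s = ?plus (a, b)" by auto
      with plus show "s \<in> rearrangements v" by blast
    qed
    show "\<forall>s\<in>rearrangements v. ?plus (?split s) = s" by (auto simp: fun_eq_iff)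
    show "?split ` rearrangements v \<subseteq> D"
    proof
      fix z assume "z \<in> ?split ` rearrangements v"
      then obtain p where p: "p permutes UNIV" "z = ?split (v \<circ> p)"
        by (auto simp: rearrangements_def)
      then have "z = (u \<circ> p, w \<circ> p)" by (simp add: u_def w_def fun_eq_iff)
      with p(1) show "z \<in> D" by (auto simp: D_def S_def rearrangements_def uw)
    qed
  qed
  then have "(\<Sum>z\<in>D. monomial_tensor (?plus z)) = (orbit_sum v :: ('k, 'm, 'n) tensor_power)"
    unfolding orbit_sum_def by (rule sum.reindex_bij_betw)
  moreover have "(orbit_sum u * orbit_sum w :: ('k, 'm, 'n) tensor_power) = (\<Sum>z\<in>S. monomial_tensor (?plus z))"
    by (simp add: orbit_sum_def sum_product sum.cartesian_product S_def monomial_tensor_mult case_prod_unfold)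
  \<comment> \<open>Different collided pairs may have the same sum, so \<open>p\<close> records
    multiplicities.\<close>
  moreover define p :: "('n \<Rightarrow> 'm \<Rightarrow>\<^sub>0 nat) \<Rightarrow>\<^sub>0 'k" where "p = (\<Sum>z\<in>S - D. Poly_Mapping.single (?plus z) 1)"
  moreover have "monomial_combination p = (\<Sum>z\<in>S - D. monomial_tensor (?plus z))"
    by (simp add: p_def monomial_combination.sum monomial_combination_single tensor_const.one)
  ultimately have eq: "(orbit_sum u * orbit_sum w :: ('k, 'm, 'n) tensor_power) = orbit_sum v + monomial_combination p"
    by (simp add: sum.subset_diff[OF D S] add.commute)
  have "card {i. a i \<noteq> 0} < card {i. v i \<noteq> 0}" if "a \<in> Poly_Mapping.keys p" for a
  proof -
    have "Poly_Mapping.keys p \<subseteq> (\<Union>z\<in>S - D. {?plus z})"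
      unfolding p_def using keys_sum by (rule order_trans) auto
    with that obtain z where "z \<in> S - D" "a = ?plus z" by blast
    then obtain b c where bc: "b \<in> rearrangements u" "c \<in> rearrangements w"
      "\<not> (\<forall>i. b i = 0 \<or> c i = 0)" and a: "a = (\<lambda>i. b i + c i)"
      by (cases z) (auto simp: D_def S_def)
    have "card {i. a i \<noteq> 0} \<le> card ({i. b i \<noteq> 0} \<union> {i. c i \<noteq> 0})"
      by (rule card_mono) (auto simp: a)
    also have "\<dots> < card {i. b i \<noteq> 0} + card {i. c i \<noteq> 0}"
    proof -
      \<comment> \<open>A collision lies in both supports and makes the union strictly smaller than
        the sum of the sizes.\<close>
      have "card ({i. b i \<noteq> 0} \<inter> {i. c i \<noteq> 0}) > 0" using bc(3) by (auto simp: card_gt_0_iff)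
      then show ?thesis using card_Un_Int[of "{i. b i \<noteq> 0}" "{i. c i \<noteq> 0}"] by simp
    qed
    also have "\<dots> = card {i. u i \<noteq> 0} + card {i. w i \<noteq> 0}"
      using card_rearrangement[OF bc(1), of "\<lambda>x. x \<noteq> 0"] card_rearrangement[OF bc(2), of "\<lambda>x. x \<noteq> 0"] by simp
    also have "\<dots> = card ({i. u i \<noteq> 0} \<union> {i. w i \<noteq> 0})"
      by (rule card_Un_disjoint[symmetric]) (auto simp: u_def w_def)
    also have "{i. u i \<noteq> 0} \<union> {i. w i \<noteq> 0} = {i. v i \<noteq> 0}"
      using \<open>\<mu> \<noteq> 0\<close> by (auto simp: u_def w_def)
    finally show ?thesis .
  qed
  with eq show thesis by (rule that)
qed

text \<open>Strong induction on the number of nonzero slots of \<open>v\<close>. The slots sharing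
  one nonzero value give an elementary symmetric tensor, the remaining ones a shorter orbit sum, and
  by \<open>orbit_sum_split\<close> their product is the orbit sum of \<open>v\<close> up to terms
  with fewer nonzero slots. No division occurs.\<close>

lemma TS_subset_subalgebra:
  fixes B :: "('k::comm_ring_1, 'm, 'n::finite) tensor_power set"
  assumes B: "is_subalgebra tensor_const B"
    and elementary: "\<And>k f. 1 \<le> k \<Longrightarrow> k \<le> CARD('n) \<Longrightarrow> elementary_symmetric k f \<in> B"
  shows "TS \<subseteq> B"
proof -
  have const: "tensor_const c \<in> B" for c using B by (auto simp: is_subalgebra_def)
  have add: "x + y \<in> B" and diff: "x - y \<in> B" and mult: "x * y \<in> B" if "x \<in> B" "y \<in> B" for x y
    using B that by (auto simp: is_subalgebra_def)
  have zero: "0 \<in> B" and one: "1 \<in> B" using const[of 0] const[of 1] by (simp_all add: tensor_const.zero tensor_const.one)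
  have orbit: "orbit_sum v \<in> B" for v :: "'n \<Rightarrow> 'm \<Rightarrow>\<^sub>0 nat"
  proof (induction "card {i. v i \<noteq> 0}" arbitrary: v rule: less_induct)
    case less
    show ?case
    proof (cases "\<forall>i. v i = 0")
      case True
      then have "rearrangements v \<subseteq> {v}" by (auto simp: rearrangements_def fun_eq_iff)
      then have "rearrangements v = {v}" using rearrangements_self[of v] by blast
      then show ?thesis using True by (simp add: orbit_sum_def monomial_tensor_def pure_tensor_one one)
    next
      case False
      then obtain j where j: "v j \<noteq> 0" by blast
      define u where "u = (\<lambda>i. if v i = v j then v j else 0)"
      define w where "w = (\<lambda>i. if v i = v j then 0 else v i)"
      obtain p where p: "(orbit_sum u * orbit_sum w :: ('k, 'm, 'n) tensor_power) = orbit_sum v + monomial_combination p"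
        and small: "\<And>a. a \<in> Poly_Mapping.keys p \<Longrightarrow> card {i. a i \<noteq> 0} < card {i. v i \<noteq> 0}"
        unfolding u_def w_def using orbit_sum_split[OF j, of v, where 'k = 'k] by blast
      have "orbit_sum u = (elementary_symmetric (card {i. v i = v j}) (Poly_Mapping.single (v j) 1) :: ('k, 'm, 'n) tensor_power)"
        using orbit_sum_constant[OF j, of "{i. v i = v j}"] by (simp add: u_def)
      moreover have "card {i. v i = v j} > 0" by (auto simp: card_gt_0_iff)
      moreover have "card {i. v i = v j} \<le> CARD('n)" by (rule card_mono) auto
      ultimately have u: "orbit_sum u \<in> B" by (simp add: elementary)
      have w: "orbit_sum w \<in> B"
      proof (rule less)
        have "{i. w i \<noteq> 0} \<subset> {i. v i \<noteq> 0}" using j by (auto simp: w_def)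
        then show "card {i. w i \<noteq> 0} < card {i. v i \<noteq> 0}" by (intro psubset_card_mono) auto
      qed
      \<comment> \<open>As a difference of symmetric tensors the remainder is symmetric, hence a
        combination of orbit sums covered by the induction hypothesis.\<close>
      have comb: "(monomial_combination p :: ('k, 'm, 'n) tensor_power) = orbit_sum u * orbit_sum w - orbit_sum v"
        by (simp add: p)
      have "(monomial_combination p :: ('k, 'm, 'n) tensor_power) \<in> TS"
        unfolding comb by (intro TS_diff TS_mult orbit_sum_in_TS)
      then have "monomial_combination p \<in> B"
        by (induction rule: TS_orbit_induct) (auto intro: zero add mult const less small)
      with u w have "orbit_sum u * orbit_sum w - monomial_combination p \<in> B" by (intro diff mult)
      then show ?thesis by (simp add: comb)
    qed
  qed
  show ?thesis
  proof
    fix x :: "('k, 'm, 'n) tensor_power"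
    assume "x \<in> TS"
    moreover obtain p where x: "x = monomial_combination p" using monomial_combination_surj by blast
    ultimately have "monomial_combination p \<in> TS" by simp
    then show "x \<in> B" unfolding x
      by (induction rule: TS_orbit_induct) (auto intro: zero add mult const orbit)
  qed
qed

section \<open>The isomorphism\<close>

lemma is_subalgebra_generated: "is_subalgebra \<iota> (subalgebra_generated \<iota> G)"
  unfolding subalgebra_generated_def hull_def is_subalgebra_def by blast

lemma charpoly_coeff_in_CP: "1 \<le> k \<Longrightarrow> k \<le> CARD('n) \<Longrightarrow> (charpoly_coeff k f :: ('k::comm_ring_1, 'm::finite, 'n::finite) AP) \<in> CP"
  unfolding CP_def subalgebra_generated_def by (rule hull_inc) blast

text \<open>The image of \<open>TS\<close> is a subalgebra because \<open>det_lift\<close> is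
  multiplicative there, and it contains the generators of \<open>CP\<close> as images of elementary
  symmetric tensors.\<close>

lemma CP_subset_det_lift: "CP \<subseteq> (det_lift ` TS :: ('k::comm_ring_1, 'm::finite, 'n::finite) AP set)"
  unfolding CP_def subalgebra_generated_def
proof (rule hull_minimal)
  show "{charpoly_coeff k f | k f. 1 \<le> k \<and> k \<le> CARD('n)} \<subseteq> (det_lift ` TS :: ('k, 'm, 'n) AP set)"
    using elementary_symmetric_in_TS by (force simp flip: det_lift_elementary_symmetric)
  have "AP_const c \<in> (det_lift ` TS :: ('k, 'm, 'n) AP set)" for c
    using TS_const by (force simp flip: det_lift_const)
  moreover have "det_lift x + det_lift y \<in> det_lift ` TS" "det_lift x - det_lift y \<in> det_lift ` TS"
    "det_lift x * det_lift y \<in> det_lift ` TS" if "x \<in> TS" "y \<in> TS" for x y :: "('k, 'm, 'n) tensor_power"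
    using that by (auto intro: TS_add TS_diff TS_mult simp flip: det_lift.add det_lift.diff det_lift_mult_TS)
  ultimately show "is_subalgebra AP_const (det_lift ` TS :: ('k, 'm, 'n) AP set)"
    by (auto simp: is_subalgebra_def)
qed

text \<open>Existence. The restriction to \<open>TS\<close> makes the function extensional, as the
  uniqueness statement requires.\<close>

lemma is_Roby_hom_det_lift:
  "is_Roby_hom (restrict det_lift TS :: ('k::comm_ring_1, 'm::finite, 'n::finite) tensor_power \<Rightarrow> ('k, 'm, 'n) AP)"
  unfolding is_Roby_hom_def
proof (intro conjI allI)
  let ?\<alpha> = "restrict det_lift TS :: ('k, 'm, 'n) tensor_power \<Rightarrow> ('k, 'm, 'n) AP"
  show "is_TS_hom ?\<alpha>"
    by (simp add: is_TS_hom_def TS_const TS_add TS_mult det_lift_const det_lift.add det_lift_mult_TS)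
  show "?\<alpha> (pure_tensor (\<lambda>_. f)) = det (eval_poly f)" for f
  proof -
    have "pure_tensor (\<lambda>_. f) \<in> (TS :: ('k, 'm, 'n) tensor_power set)"
      by (simp add: TS_def permute_pure_tensor o_def)
    then show ?thesis by (simp add: det_lift_pure_tensor)
  qed
  show "Poly_Mapping.map ?\<alpha> (tensor_power_of f) = det (eval_base_change f)" for f
  proof -
    \<comment> \<open>The coefficient formula for \<open>Poly_Mapping.map\<close> asks that the map
      send 0 to 0; since 0 lies in \<open>TS\<close>, the restriction does not take its default
      value there.\<close>
    have "(0 :: ('k, 'm, 'n) tensor_power) \<in> TS"
      using TS_const[of 0] by (simp add: tensor_const.zero)
    then have "?\<alpha> 0 = 0" by (simp add: det_lift.zero)
    then have "Poly_Mapping.map ?\<alpha> (tensor_power_of f) = Poly_Mapping.map det_lift (tensor_power_of f)"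
      by (intro poly_mapping_eqI) (simp add: lookup_map_zero det_lift.zero tensor_power_of_in_TS)
    then show ?thesis by (simp add: det_lift_base_change)
  qed
qed

text \<open>The symmetric tensors on which \<open>\<alpha>\<close> agrees with
  \<open>det_lift\<close>, with value in \<open>CP\<close>, form a subalgebra. It contains the
  elementary symmetric tensors and is therefore all of \<open>TS\<close>. This yields uniqueness and
  one inclusion for the image.\<close>

lemma Roby_hom_eq_det_lift:
  fixes \<alpha> :: "('k::comm_ring_1, 'm::finite, 'n::finite) tensor_power \<Rightarrow> ('k, 'm, 'n) AP"
  assumes \<alpha>: "is_Roby_hom \<alpha>" and "x \<in> TS"
  shows "\<alpha> x = det_lift x" and "det_lift x \<in> CP"
proof -
  have const: "\<alpha> (tensor_const c) = AP_const c" for c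
    using \<alpha> by (simp add: is_Roby_hom_def is_TS_hom_def)
  have add: "\<alpha> (x + y) = \<alpha> x + \<alpha> y" and mult: "\<alpha> (x * y) = \<alpha> x * \<alpha> y" if "x \<in> TS" "y \<in> TS" for x y
    using \<alpha> that by (auto simp: is_Roby_hom_def is_TS_hom_def)
  have diff: "\<alpha> (x - y) = \<alpha> x - \<alpha> y" if "x \<in> TS" "y \<in> TS" for x y
    using add[OF TS_diff[OF that] that(2)] by simp
  have zero: "\<alpha> 0 = 0" using const[of 0] by (simp add: tensor_const.zero AP_const.zero)
  have law: "\<alpha> (Poly_Mapping.lookup (tensor_power_of f) k) = det_lift (Poly_Mapping.lookup (tensor_power_of f) k)" for f k
  proof -
    have "Poly_Mapping.map \<alpha> (tensor_power_of f) = Poly_Mapping.map det_lift (tensor_power_of f)"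
      using \<alpha> by (simp add: is_Roby_hom_def det_lift_base_change)
    from arg_cong[OF this, of "\<lambda>p. Poly_Mapping.lookup p k"] show ?thesis
      by (simp add: lookup_map_zero zero det_lift.zero)
  qed
  have CP: "is_subalgebra AP_const (CP :: ('k, 'm, 'n) AP set)"
    unfolding CP_def by (rule is_subalgebra_generated)
  let ?B = "{x \<in> TS. \<alpha> x = det_lift x \<and> det_lift x \<in> CP}"
  have "TS \<subseteq> ?B"
  proof (rule TS_subset_subalgebra)
    show "is_subalgebra tensor_const ?B"
      using CP
      by (auto simp: is_subalgebra_def TS_const TS_add TS_diff TS_mult const add diff mult
          det_lift_const det_lift.add det_lift.diff det_lift_mult_TS)
    \<comment> \<open>An elementary symmetric tensor is a coefficient of a tensor power, so
      \<open>law\<close> applies, and its image is a generator of \<open>CP\<close>.\<close>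
    show "elementary_symmetric k f \<in> ?B" if "1 \<le> k" "k \<le> CARD('n)" for k f
      using that law[of _ "Poly_Mapping.single 0 (CARD('n) - k)"]
      by (simp add: elementary_symmetric_in_TS det_lift_elementary_symmetric charpoly_coeff_in_CP
          flip: elementary_symmetric_eq_lookup)
        (simp add: elementary_symmetric_eq_lookup law flip: det_lift_elementary_symmetric)
  qed
  with \<open>x \<in> TS\<close> show "\<alpha> x = det_lift x" "det_lift x \<in> CP" by auto
qed

theorem theorem1:
  "(\<exists>!\<alpha> :: ('k::comm_ring_1, 'm::finite, 'n::finite) tensor_power \<Rightarrow> ('k, 'm, 'n) AP.
      \<alpha> \<in> TS \<rightarrow>\<^sub>E UNIV \<and> is_Roby_hom \<alpha>) \<and>
   (\<forall>\<alpha> :: ('k, 'm, 'n) tensor_power \<Rightarrow> ('k, 'm, 'n) AP.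
      is_Roby_hom \<alpha> \<longrightarrow> inj_on \<alpha> TS \<and> \<alpha> ` TS = CP)"
proof (intro conjI allI impI)
  show "\<exists>!\<alpha> :: ('k, 'm, 'n) tensor_power \<Rightarrow> ('k, 'm, 'n) AP. \<alpha> \<in> TS \<rightarrow>\<^sub>E UNIV \<and> is_Roby_hom \<alpha>"
  proof (rule ex1I[of _ "restrict det_lift TS"])
    show "restrict det_lift TS \<in> TS \<rightarrow>\<^sub>E UNIV \<and> is_Roby_hom (restrict det_lift TS)"
      by (simp add: is_Roby_hom_det_lift)
    show "\<alpha> = restrict det_lift TS" if "\<alpha> \<in> TS \<rightarrow>\<^sub>E UNIV \<and> is_Roby_hom \<alpha>"
      for \<alpha> :: "('k, 'm, 'n) tensor_power \<Rightarrow> ('k, 'm, 'n) AP"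
      using that by (auto simp: PiE_iff intro!: extensionalityI[of _ TS] Roby_hom_eq_det_lift(1))
  qed
  fix \<alpha> :: "('k, 'm, 'n) tensor_power \<Rightarrow> ('k, 'm, 'n) AP"
  assume \<alpha>: "is_Roby_hom \<alpha>"
  show "inj_on \<alpha> TS"
    \<comment> \<open>Restriction to diagonal matrices is the left inverse.\<close>
    by (rule inj_on_inverseI[of _ diagonal]) (simp add: Roby_hom_eq_det_lift(1)[OF \<alpha>] diagonal_det_lift)
  have "\<alpha> ` TS = det_lift ` TS"
    by (rule image_cong) (simp_all add: Roby_hom_eq_det_lift(1)[OF \<alpha>])
  moreover have "det_lift ` TS \<subseteq> (CP :: ('k, 'm, 'n) AP set)"
    by (rule image_subsetI) (rule Roby_hom_eq_det_lift(2)[OF \<alpha>])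
  ultimately show "\<alpha> ` TS = CP"
    using CP_subset_det_lift by (metis subset_antisym)
qed

end
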